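(* Let $\bar\nu_0=n-\bar\nu_1-\cdots-\bar\nu_p$ and write $\mathcal R_0(\lambda)=\mathcal R(\lambda)$. Problem 3A (stated in the context) is solvable if and only if $$\dim\Big(\sum_{(i,j)\in P}\mathcal R_i(\lambda_{i,j})\Big)\ge\operatorname{card}P$$ for all $P$ in the power set $2^I$, where $I=\{(0,1),\ldots,(0,\bar\nu_0),(1,1),\ldots,(1,\bar\nu_1),\ldots,(p,1),\ldots,(p,\bar\nu_p)\}$.
   Context: System: $\Sigma=(A,B,C,D)$ is $\mathcal D x=Ax+Bu$, $y=Cx+Du$, $x(t)\in\mathbb R^n$, $u(t)\in\mathbb R^m$, $y(t)\in\mathbb R^p$, real matrices; $\mathcal D x=\dot x$ (continuous time) or $x(t+1)$ (discrete time). $\mathbb C_g$ is the open left half-plane (continuous) or open unit disc (discrete), $\mathbb R_g=\mathbb C_g\cap\mathbb R$. Invariant zeros of $\Sigma$ are those $\lambda\in\mathbb C$ at which the rank of $\begin{bmatrix}A-\lambda I&B\\C&D\end{bmatrix}$ is below its normal rank; minimum-phase zeros are those in $\mathbb C_g$. Standing assumptions: $\Sigma$ is right invertible (that matrix pencil has full row rank for all but finitely many $\lambda$), stabilizable, with no invariant zero at $0$ (continuous) or $1$ (discrete); algebraic and geometric multiplicities of each minimum-phase invariant zero coincide; no Jordan chains are allowed in the closed loop ($A+BF$ diagonalizable); in this part all closed-loop eigenvalues considered and all minimum-phase invariant zeros are real. Control: $u=Fx+Gr$, $F$ real with $\sigma(A+BF)\subset\mathbb C_g$, $G$ a right inverse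 of the closed-loop static gain. For constant $r$, $\epsilon=y-r$ satisfies $\mathcal D\xi=(A+BF)\xi$, $\epsilon=(C+DF)\xi$. State-to-output decoupling (with $\nu_i$ modes in output $i$): for any initial condition, $\epsilon_i(t)=\sum_{j=1}^{\nu_i}\beta_{i,j}e^{\mu_{i,j}t}$ (resp. $\sum_j\beta_{i,j}\mu_{i,j}^t$), $i=1,\ldots,p$, where the $\mu_{i,j}$ are the observable closed-loop eigenvalues and the coefficients $\beta_{i,j}$ can be made arbitrary by choice of $\xi(0)$. That is, $A+BF$ has a basis of eigenvectors $v_{0,1},\ldots,v_{0,\nu_0},v_{1,1},\ldots,v_{p,\nu_p}$ with eigenvalues $\mu_{i,j}$ such that $(C+DF)v_{0,j}=0$ and $(C+DF)v_{i,j}$ is a nonzero multiple of the $i$-th canonical vector $e_i\in\mathbb R^p$ for $i\ge1$; the $\mu_{i,j}$ ($1\le j\le\nu_i$) are the eigenvalues observable from $\epsilon_i$ and the $\mu_{0,j}$ the unobservable ones (all counted with multiplicity). Problem 3A: given nonnegative integers $\bar\nu_1,\ldots,\bar\nu_p$ with $\bar\nu_0=n-\sum_i\bar\nu_i\ge0$, and assigned $\lambda_{i,j}\in\mathbb R_g$ ($i=0,\ldots,p$, $j=1,\ldots,\bar\nu_i$), allowed to be minimum-phase invariant zeros, find $F,G$ such that: (1) $y(t)\to\bar r$ for every constant reference $r(t)=\bar r$; (2) state-to-output decoupling is achieved; (3) from each $\epsilon_i$ at most $\bar\nu_i$ eigenvalues are observable ($\nu_i\le\bar\nu_i$); and the closed-loop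 eigenvalues are $\{\lambda_{i,j}\}_{i=0,\ldots,p,\,j=1,\ldots,\bar\nu_i}$, those observable from $\epsilon_i$ are a subset (sub-multiset) of $\{\lambda_{i,j}\}_{j=1,\ldots,\bar\nu_i}$, and the unobservable ones contain $\{\lambda_{0,j}\}_{j=1,\ldots,\bar\nu_0}$. Solvable means such $F,G$ exist. Subspaces, for real $\lambda$: $\mathcal R(\lambda)=\{v\in\mathbb R^n\mid\exists w\in\mathbb R^m:\ (A-\lambda I)v+Bw=0,\ Cv+Dw=0\}$; $\mathcal R_i(\lambda)=\{v\in\mathbb R^n\mid\exists w\in\mathbb R^m:\ (A-\lambda I)v+Bw=0,\ C_{(i)}v+D_{(i)}w=0\}$ for $i\ge1$, where $C_{(i)},D_{(i)}$ are $C,D$ with the $i$-th row removed. *)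

theory Defs
  imports
    "HOL-Analysis.Analysis"
    "HOL-Computational_Algebra.Polynomial_Factorial"
    "HOL-Computational_Algebra.Field_as_Ring"
    "HOL-Library.Multiset"
begin

datatype time_domain = Continuous | Discrete

definition stable_region :: "time_domain \<Rightarrow> complex set" where
  "stable_region td = (case td of Continuous \<Rightarrow> {z. Re z < 0} | Discrete \<Rightarrow> {z. cmod z < 1})"

text \<open>The frequency of constant signals: \<open>s = 0\<close>, respectively \<open>z = 1\<close>.\<close>

definition dc_point :: "time_domain \<Rightarrow> real" where
  "dc_point td = (case td of Continuous \<Rightarrow> 0 | Discrete \<Rightarrow> 1)"

definition spectrum :: "real^'n^'n \<Rightarrow> complex set" where
  "spectrum M = {z. \<exists>v. v \<noteq> 0 \<and> map_matrix complex_of_real M *v v = z *s v}"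

definition stabilizable :: "time_domain \<Rightarrow> real^'n^'n \<Rightarrow> real^'m^'n \<Rightarrow> bool" where
  "stabilizable td A B \<longleftrightarrow> (\<exists>F :: real^'n^'m. spectrum (A + B ** F) \<subseteq> stable_region td)"

text \<open>The system matrix pencil with blocks \<open>A - s I\<close>, \<open>B\<close>, \<open>C\<close>, \<open>D\<close>, as a polynomial matrix
  in \<open>s\<close>; the block structure is carried by the sum types indexing rows and columns.\<close>

definition pencil ::
  "real^'n^'n \<Rightarrow> real^'m^'n \<Rightarrow> real^'n^'p \<Rightarrow> real^'m^'p \<Rightarrow> complex poly^('n + 'm)^('n + 'p)" where
  "pencil A B C D = (\<chi> r c. case r of
      Inl i \<Rightarrow> (case c of
          Inl j \<Rightarrow> [:complex_of_real (A $ i $ j):] - (if i = j then [:0, 1:] else 0)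
        | Inr j \<Rightarrow> [:complex_of_real (B $ i $ j):])
    | Inr i \<Rightarrow> (case c of
          Inl j \<Rightarrow> [:complex_of_real (C $ i $ j):]
        | Inr j \<Rightarrow> [:complex_of_real (D $ i $ j):]))"

definition eval_at :: "complex poly^'c^'r \<Rightarrow> complex \<Rightarrow> complex^'c^'r" where
  "eval_at P z = map_matrix (\<lambda>q. poly q z) P"

definition normal_rank :: "complex poly^'c^'r \<Rightarrow> nat" where
  "normal_rank P = Max (range (\<lambda>z. rank (eval_at P z)))"

definition right_invertible ::
  "real^'n^'n \<Rightarrow> real^'m^'n \<Rightarrow> real^'n^'p \<Rightarrow> real^'m^'p \<Rightarrow> bool" where
  "right_invertible A B C D \<longleftrightarrow>
     finite {z. rank (eval_at (pencil A B C D) z) \<noteq> CARD('n) + CARD('p)}"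

definition invariant_zero ::
  "real^'n^'n \<Rightarrow> real^'m^'n \<Rightarrow> real^'n^'p \<Rightarrow> real^'m^'p \<Rightarrow> complex \<Rightarrow> bool" where
  "invariant_zero A B C D z \<longleftrightarrow>
     rank (eval_at (pencil A B C D) z) < normal_rank (pencil A B C D)"

definition minimum_phase_zero ::
  "time_domain \<Rightarrow> real^'n^'n \<Rightarrow> real^'m^'n \<Rightarrow> real^'n^'p \<Rightarrow> real^'m^'p \<Rightarrow> complex \<Rightarrow> bool" where
  "minimum_phase_zero td A B C D z \<longleftrightarrow> invariant_zero A B C D z \<and> z \<in> stable_region td"

text \<open>The algebraic multiplicity of a zero \<open>z\<close> is the degree of the product of the elementary
  divisors of the pencil at \<open>z\<close>, i.e. the total order of \<open>z\<close> as a root of the invariant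
  polynomials.  The \<open>k\<close>-th invariant polynomial is the quotient of consecutive determinantal
  divisors, these being the monic gcds of all minors of a given size.  The geometric multiplicity
  is the rank drop, i.e. the number of elementary divisors at \<open>z\<close>.\<close>

definition minor :: "'a::comm_ring_1^'c^'r \<Rightarrow> nat \<Rightarrow> (nat \<Rightarrow> 'r) \<Rightarrow> (nat \<Rightarrow> 'c) \<Rightarrow> 'a" where
  "minor P k f g = (\<Sum>\<pi> | \<pi> permutes {..<k}. of_int (sign \<pi>) * (\<Prod>i<k. P $ f i $ g (\<pi> i)))"

definition determinantal_divisor :: "complex poly^'c^'r \<Rightarrow> nat \<Rightarrow> complex poly" where
  "determinantal_divisor P k = Gcd {minor P k f g | f g. inj_on f {..<k} \<and> inj_on g {..<k}}"

definition invariant_poly :: "complex poly^'c^'r \<Rightarrow> nat \<Rightarrow> complex poly" where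
  "invariant_poly P k = determinantal_divisor P k div determinantal_divisor P (k - 1)"

definition algebraic_mult :: "complex poly^'c^'r \<Rightarrow> complex \<Rightarrow> nat" where
  "algebraic_mult P z = (\<Sum>k = 1..normal_rank P. order z (invariant_poly P k))"

definition geometric_mult :: "complex poly^'c^'r \<Rightarrow> complex \<Rightarrow> nat" where
  "geometric_mult P z = normal_rank P - rank (eval_at P z)"

definition ct_solution ::
  "real^'n^'n \<Rightarrow> (real \<Rightarrow> real^'n) \<Rightarrow> (real \<Rightarrow> real^'n) \<Rightarrow> bool" where
  "ct_solution M b x \<longleftrightarrow>
     (\<forall>t\<ge>0. (x has_vector_derivative (M *v x t + b t)) (at t within {0..}))"

definition dt_solution ::
  "real^'n^'n \<Rightarrow> (nat \<Rightarrow> real^'n) \<Rightarrow> (nat \<Rightarrow> real^'n) \<Rightarrow> bool" where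
  "dt_solution M b x \<longleftrightarrow> (\<forall>t. x (Suc t) = M *v x t + b t)"

definition tracks_constant_references ::
  "time_domain \<Rightarrow> real^'n^'n \<Rightarrow> real^'m^'n \<Rightarrow> real^'n^'p \<Rightarrow> real^'m^'p \<Rightarrow>
   real^'n^'m \<Rightarrow> real^'p^'m \<Rightarrow> bool" where
  "tracks_constant_references td A B C D F G \<longleftrightarrow> (\<forall>r. case td of
      Continuous \<Rightarrow> \<forall>x u. u = (\<lambda>t. F *v x t + G *v r) \<and> ct_solution A (\<lambda>t. B *v u t) x \<longrightarrow>
        ((\<lambda>t. C *v x t + D *v u t) \<longlongrightarrow> r) at_top
    | Discrete \<Rightarrow> \<forall>x u. u = (\<lambda>t. F *v x t + G *v r) \<and> dt_solution A (\<lambda>t. B *v u t) x \<longrightarrow>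
        (\<lambda>t. C *v x t + D *v u t) \<longlonglongrightarrow> r)"

definition static_gain ::
  "time_domain \<Rightarrow> real^'n^'n \<Rightarrow> real^'m^'n \<Rightarrow> real^'n^'p \<Rightarrow> real^'m^'p \<Rightarrow> real^'n^'m \<Rightarrow> real^'m^'p"
  where
  "static_gain td A B C D F =
     (C + D ** F) ** matrix_inv (dc_point td *\<^sub>R mat 1 - (A + B ** F)) ** B + D"

text \<open>Families of modes are indexed by \<open>(i, j)\<close> with \<open>1 \<le> j \<le> \<nu> i\<close>: \<open>i = Some k\<close> refers to the
  output \<open>k\<close>, and \<open>i = None\<close> plays the role of the index \<open>0\<close> (unobservable modes).\<close>

definition mode_indices :: "('p option \<Rightarrow> nat) \<Rightarrow> ('p option \<times> nat) set" where
  "mode_indices \<nu> = (SIGMA i:UNIV. {1..\<nu> i})"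

definition modes :: "('p option \<Rightarrow> nat) \<Rightarrow> ('p option \<Rightarrow> nat \<Rightarrow> real) \<Rightarrow> 'p option \<Rightarrow> real multiset"
  where
  "modes \<nu> \<mu> i = image_mset (\<mu> i) (mset_set {1..\<nu> i})"

text \<open>The tracking error obeys \<open>\<D>\<xi> = (A + B F) \<xi>\<close>, \<open>\<epsilon> = (C + D F) \<xi>\<close>.\<close>

definition decoupled_responses ::
  "time_domain \<Rightarrow> real^'n^'n \<Rightarrow> real^'m^'n \<Rightarrow> real^'n^'p \<Rightarrow> real^'m^'p \<Rightarrow> real^'n^'m \<Rightarrow>
   ('p option \<Rightarrow> nat) \<Rightarrow> ('p option \<Rightarrow> nat \<Rightarrow> real) \<Rightarrow> bool" where
  "decoupled_responses td A B C D F \<nu> \<mu> \<longleftrightarrow> (case td of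
      Continuous \<Rightarrow>
        (let response = (\<lambda>\<xi> \<beta>. \<forall>t\<ge>0. \<forall>i. ((C + D ** F) *v \<xi> t) $ i =
               (\<Sum>j = 1..\<nu> (Some i). \<beta> i j * exp (\<mu> (Some i) j * t)))
         in (\<forall>\<xi>. ct_solution (A + B ** F) (\<lambda>_. 0) \<xi> \<longrightarrow> (\<exists>\<beta>. response \<xi> \<beta>)) \<and>
            (\<forall>\<beta>. \<exists>\<xi>. ct_solution (A + B ** F) (\<lambda>_. 0) \<xi> \<and> response \<xi> \<beta>))
    | Discrete \<Rightarrow>
        (let response = (\<lambda>\<xi> \<beta>. \<forall>t. \<forall>i. ((C + D ** F) *v \<xi> t) $ i =
               (\<Sum>j = 1..\<nu> (Some i). \<beta> i j * \<mu> (Some i) j ^ t))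
         in (\<forall>\<xi>. dt_solution (A + B ** F) (\<lambda>_. 0) \<xi> \<longrightarrow> (\<exists>\<beta>. response \<xi> \<beta>)) \<and>
            (\<forall>\<beta>. \<exists>\<xi>. dt_solution (A + B ** F) (\<lambda>_. 0) \<xi> \<and> response \<xi> \<beta>)))"

definition decoupling_eigenbasis ::
  "real^'n^'n \<Rightarrow> real^'m^'n \<Rightarrow> real^'n^'p \<Rightarrow> real^'m^'p \<Rightarrow> real^'n^'m \<Rightarrow>
   ('p option \<Rightarrow> nat) \<Rightarrow> ('p option \<Rightarrow> nat \<Rightarrow> real) \<Rightarrow> ('p option \<Rightarrow> nat \<Rightarrow> real^'n) \<Rightarrow> bool" where
  "decoupling_eigenbasis A B C D F \<nu> \<mu> v \<longleftrightarrow>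
     inj_on (\<lambda>(i, j). v i j) (mode_indices \<nu>) \<and>
     independent ((\<lambda>(i, j). v i j) ` mode_indices \<nu>) \<and>
     span ((\<lambda>(i, j). v i j) ` mode_indices \<nu>) = UNIV \<and>
     (\<forall>(i, j) \<in> mode_indices \<nu>. (A + B ** F) *v v i j = \<mu> i j *\<^sub>R v i j) \<and>
     (\<forall>j \<in> {1..\<nu> None}. (C + D ** F) *v v None j = 0) \<and>
     (\<forall>i. \<forall>j \<in> {1..\<nu> (Some i)}. \<exists>c. c \<noteq> 0 \<and> (C + D ** F) *v v (Some i) j = c *\<^sub>R axis i 1)"

definition state_output_decoupled ::
  "time_domain \<Rightarrow> real^'n^'n \<Rightarrow> real^'m^'n \<Rightarrow> real^'n^'p \<Rightarrow> real^'m^'p \<Rightarrow> real^'n^'m \<Rightarrow>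
   ('p option \<Rightarrow> nat) \<Rightarrow> ('p option \<Rightarrow> nat \<Rightarrow> real) \<Rightarrow> bool" where
  "state_output_decoupled td A B C D F \<nu> \<mu> \<longleftrightarrow>
     decoupled_responses td A B C D F \<nu> \<mu> \<and> (\<exists>v. decoupling_eigenbasis A B C D F \<nu> \<mu> v)"

definition solves_problem_3A ::
  "time_domain \<Rightarrow> real^'n^'n \<Rightarrow> real^'m^'n \<Rightarrow> real^'n^'p \<Rightarrow> real^'m^'p \<Rightarrow>
   ('p option \<Rightarrow> nat) \<Rightarrow> ('p option \<Rightarrow> nat \<Rightarrow> real) \<Rightarrow> real^'n^'m \<Rightarrow> real^'p^'m \<Rightarrow> bool" where
  "solves_problem_3A td A B C D \<nu>bar lam F G \<longleftrightarrow>
     spectrum (A + B ** F) \<subseteq> stable_region td \<and>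
     static_gain td A B C D F ** G = mat 1 \<and>
     tracks_constant_references td A B C D F G \<and>
     (\<exists>\<nu> \<mu>. state_output_decoupled td A B C D F \<nu> \<mu> \<and>
        (\<forall>i. \<nu> (Some i) \<le> \<nu>bar (Some i)) \<and>
        (\<Sum>i\<in>UNIV. modes \<nu> \<mu> i) = (\<Sum>i\<in>UNIV. modes \<nu>bar lam i) \<and>
        (\<forall>i. modes \<nu> \<mu> (Some i) \<subseteq># modes \<nu>bar lam (Some i)) \<and>
        modes \<nu>bar lam None \<subseteq># modes \<nu> \<mu> None)"

definition solvable_3A ::
  "time_domain \<Rightarrow> real^'n^'n \<Rightarrow> real^'m^'n \<Rightarrow> real^'n^'p \<Rightarrow> real^'m^'p \<Rightarrow>
   ('p option \<Rightarrow> nat) \<Rightarrow> ('p option \<Rightarrow> nat \<Rightarrow> real) \<Rightarrow> bool" where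
  "solvable_3A td A B C D \<nu>bar lam \<longleftrightarrow> (\<exists>F G. solves_problem_3A td A B C D \<nu>bar lam F G)"

text \<open>For \<open>i = Some k\<close> the output equation of row \<open>k\<close> is dropped; for \<open>i = None\<close> every row is kept.\<close>

definition R_space ::
  "real^'n^'n \<Rightarrow> real^'m^'n \<Rightarrow> real^'n^'p \<Rightarrow> real^'m^'p \<Rightarrow> 'p option \<Rightarrow> real \<Rightarrow> (real^'n) set" where
  "R_space A B C D i lam = {v. \<exists>w.
     (A - lam *\<^sub>R mat 1) *v v + B *v w = 0 \<and> (\<forall>k. i \<noteq> Some k \<longrightarrow> (C *v v + D *v w) $ k = 0)}"

definition subspace_sum :: "('k \<Rightarrow> 'a::real_vector set) \<Rightarrow> 'k set \<Rightarrow> 'a set" where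
  "subspace_sum S P = {\<Sum>k\<in>P. f k | f. \<forall>k\<in>P. f k \<in> S k}"

end

theory Submission
  imports Defs
begin

text \<open>The nonzero vectors of \<open>R\<^sub>i(\<lambda>)\<close> are those that some feedback turns into closed-loop eigenvectors
  for \<open>\<lambda>\<close> visible at no output other than \<open>i\<close>, so the problem asks for a basis \<open>v\<^sub>i\<^sub>j \<in> R\<^sub>i(\<lambda>\<^sub>i\<^sub>j)\<close>. By Rado's theorem on
  independent transversals, in its version for families of subspaces, such a basis exists if and
  only if the dimension inequalities hold. Since the \<open>v\<^sub>i\<^sub>j\<close> form a basis, the inputs \<open>w\<^sub>i\<^sub>j\<close> that witness
  their membership define a feedback by \<open>F v\<^sub>i\<^sub>j = w\<^sub>i\<^sub>j\<close>. The pencil has full row rank at the frequency of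
  constant signals, so the closed-loop static gain is onto and a feedforward \<open>G\<close> exists.\<close>

section \<open>Independent transversals\<close>

text \<open>Submodularity of dimension, from the dimension formula for \<open>span X\<close> and
  \<open>span Y\<close>. Only an inequality survives, because \<open>X \<inter> Y\<close> may span
  less than \<open>span X \<inter> span Y\<close>.\<close>

lemma dim_Un_Int_le:
  fixes X Y :: "'a::euclidean_space set"
  shows "dim (X \<union> Y) + dim (X \<inter> Y) \<le> dim X + dim Y"
proof -
  have "dim (X \<union> Y) = dim {x + y | x y. x \<in> span X \<and> y \<in> span Y}"
    by (metis (no_types) dim_span span_Un)
  moreover have "dim (X \<inter> Y) \<le> dim (span X \<inter> span Y)"
    by (intro dim_subset) (auto intro: span_base)
  moreover have "dim {x + y | x y. x \<in> span X \<and> y \<in> span Y} + dim (span X \<inter> span Y)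
      = dim (span X) + dim (span Y)"
    by (rule dim_sums_Int) auto
  ultimately show ?thesis by simp
qed

text \<open>The sets are thinned out one vector at a time without losing the dimension condition;
  hence the induction on their total size. Once all are singletons, the condition at
  \<open>P = U\<close> leaves no room for a repetition or a linear dependence.\<close>

theorem rado_independent_transversal:
  fixes S :: "'k \<Rightarrow> 'a::euclidean_space set"
  assumes "finite U" and "\<And>k. k \<in> U \<Longrightarrow> finite (S k)"
    and "\<And>P. P \<subseteq> U \<Longrightarrow> card P \<le> dim (\<Union>k\<in>P. S k)"
  shows "\<exists>v. (\<forall>k\<in>U. v k \<in> S k) \<and> inj_on v U \<and> independent (v ` U)"
  using assms(2,3)
proof (induction "\<Sum>k\<in>U. card (S k)" arbitrary: S rule: less_induct)
  case less
  show ?case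
  proof (cases "\<exists>k\<in>U. \<exists>a\<in>S k. \<exists>b\<in>S k. a \<noteq> b")
    case True
    then obtain k a b where k: "k \<in> U" "a \<in> S k" "b \<in> S k" "a \<noteq> b" by blast
    define T where "T c = S(k := S k - {c})" for c
    have sm: "(\<Sum>l\<in>U. card (T c l)) < (\<Sum>l\<in>U. card (S l))" if "c \<in> S k" for c
    proof (rule sum_strict_mono_ex1)
      show "\<forall>l\<in>U. card (T c l) \<le> card (S l)"
        using less.prems(1) by (auto simp: T_def intro: card_mono)
      show "\<exists>l\<in>U. card (T c l) < card (S l)"
        unfolding T_def
        by (rule bexI[OF _ k(1)]) (use card_Diff1_less[OF less.prems(1)[OF k(1)] that] in \<open>simp only: fun_upd_same\<close>)
    qed (use assms(1) in simp)
    have "\<exists>c\<in>{a, b}. \<forall>P\<subseteq>U. card P \<le> dim (\<Union>l\<in>P. T c l)"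
    proof (rule ccontr)
      \<comment> \<open>If deleting \<open>a\<close> and deleting \<open>b\<close> both violate the condition, at \<open>P\<close> and \<open>Q\<close>, then
        submodularity of \<open>dim\<close> violates it for \<open>S\<close> at \<open>P \<union> Q\<close> or at \<open>P \<inter> Q - {k}\<close>.\<close>
      assume "\<not> ?thesis"
      then obtain P Q where P: "P \<subseteq> U" "dim (\<Union>l\<in>P. T a l) < card P"
        and Q: "Q \<subseteq> U" "dim (\<Union>l\<in>Q. T b l) < card Q"
        by (auto simp: not_le)
      \<comment> \<open>A violating index set contains \<open>k\<close>, as elsewhere the deletion
        changes nothing.\<close>
      have kin: "k \<in> R" if "R \<subseteq> U" "dim (\<Union>l\<in>R. T c l) < card R" for R c
      proof (rule ccontr)
        assume "k \<notin> R"
        then have "(\<Union>l\<in>R. T c l) = (\<Union>l\<in>R. S l)" by (auto simp: T_def split: if_splits)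
        with that less.prems(2)[OF that(1)] show False by simp
      qed
      have kP: "k \<in> P" "k \<in> Q" using kin P Q by blast+
      have fin: "finite P" "finite Q" using P Q assms(1) finite_subset by blast+
      \<comment> \<open>Since \<open>a \<noteq> b\<close>, the sets \<open>S k - {a}\<close> and
        \<open>S k - {b}\<close> together still exhaust \<open>S k\<close>.\<close>
      have "(\<Union>l\<in>P. T a l) \<union> (\<Union>l\<in>Q. T b l) = (\<Union>l\<in>P\<union>Q. S l)"
        using kP k by (auto simp: T_def split: if_splits)
      moreover have "dim (\<Union>l\<in>P \<inter> Q - {k}. S l) \<le> dim ((\<Union>l\<in>P. T a l) \<inter> (\<Union>l\<in>Q. T b l))"
        by (rule dim_subset) (auto simp: T_def)
      ultimately have "dim (\<Union>l\<in>P\<union>Q. S l) + dim (\<Union>l\<in>P \<inter> Q - {k}. S l)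
          \<le> dim (\<Union>l\<in>P. T a l) + dim (\<Union>l\<in>Q. T b l)"
        using dim_Un_Int_le[of "\<Union>l\<in>P. T a l" "\<Union>l\<in>Q. T b l"]
        by simp
      moreover have "card (P \<union> Q) \<le> dim (\<Union>l\<in>P\<union>Q. S l)"
        using P Q by (intro less.prems(2)) auto
      moreover have "card (P \<inter> Q - {k}) \<le> dim (\<Union>l\<in>P \<inter> Q - {k}. S l)"
        using P Q by (intro less.prems(2)) auto
      \<comment> \<open>Dropping \<open>k\<close> costs one, while the two strict inequalities for
        \<open>P\<close> and \<open>Q\<close> gain two.\<close>
      moreover have "card (P \<inter> Q - {k}) + 1 = card (P \<inter> Q)"
        using kP fin card_Suc_Diff1[of "P \<inter> Q" k] by simp
      moreover have "card (P \<union> Q) + card (P \<inter> Q) = card P + card Q"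
        using card_Un_Int[OF fin] by simp
      ultimately show False using P(2) Q(2) by linarith
    qed
    then obtain c where c: "c \<in> {a, b}" "\<And>P. P \<subseteq> U \<Longrightarrow> card P \<le> dim (\<Union>l\<in>P. T c l)" by blast
    have "\<exists>v. (\<forall>l\<in>U. v l \<in> T c l) \<and> inj_on v U \<and> independent (v ` U)"
    proof (rule less.hyps)
      show "(\<Sum>l\<in>U. card (T c l)) < (\<Sum>l\<in>U. card (S l))" using sm c(1) k by blast
    qed (use less.prems(1) c(2) in \<open>auto simp: T_def\<close>)
    then obtain v where "\<forall>l\<in>U. v l \<in> T c l" "inj_on v U" "independent (v ` U)" by blast
    moreover have "T c l \<subseteq> S l" for l by (auto simp: T_def)
    ultimately show ?thesis by blast
  next
    case False
    have "\<exists>a. S k = {a}" if "k \<in> U" for k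
    proof -
      have "S k \<noteq> {}" using less.prems(2)[of "{k}"] that by auto
      with False that show ?thesis by blast
    qed
    then obtain v where v: "\<And>k. k \<in> U \<Longrightarrow> S k = {v k}" by metis
    then have "card U \<le> dim (v ` U)" using less.prems(2)[of U] by (simp add: UNION_singleton_eq_range)
    moreover have "dim (v ` U) \<le> card (v ` U)" using assms(1) by (simp add: dim_le_card')
    moreover have "card (v ` U) \<le> card U" using assms(1) by (rule card_image_le)
    ultimately have "card (v ` U) = card U" "card (v ` U) \<le> dim (v ` U)" by linarith+
    then have "inj_on v U" "independent (v ` U)"
      using assms(1) eq_card_imp_inj_on card_le_dim_spanning[OF order_refl span_superset, of "v ` U"]
      by blast+
    then show ?thesis using v by (intro exI[of _ v]) simp
  qed
qed

text \<open>Each subspace is replaced by a finite subset whose span contains it, so that the version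
  for finite sets applies. The span of these subsets over \<open>P\<close> contains the subspace
  sum, so the dimension condition is inherited.\<close>

lemma rado_subspaces:
  fixes S :: "'k \<Rightarrow> 'a::euclidean_space set"
  assumes "finite U" and "\<And>k. k \<in> U \<Longrightarrow> subspace (S k)"
    and "\<And>P. P \<subseteq> U \<Longrightarrow> card P \<le> dim (subspace_sum S P)"
  shows "\<exists>v. (\<forall>k\<in>U. v k \<in> S k) \<and> inj_on v U \<and> independent (v ` U)"
proof -
  have "\<exists>b. finite b \<and> b \<subseteq> S k \<and> S k \<subseteq> span b" for k
    by (metis basis_exists finiteI_independent)
  then obtain b where b: "\<And>k. finite (b k)" "\<And>k. b k \<subseteq> S k" "\<And>k. S k \<subseteq> span (b k)" by metis
  have "card P \<le> dim (\<Union>k\<in>P. b k)" if "P \<subseteq> U" for P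
  proof -
    have "subspace_sum S P \<subseteq> span (\<Union>k\<in>P. b k)"
    proof
      fix x assume "x \<in> subspace_sum S P"
      then obtain f where f: "x = (\<Sum>k\<in>P. f k)" "\<forall>k\<in>P. f k \<in> S k" by (auto simp: subspace_sum_def)
      have "f k \<in> span (\<Union>k\<in>P. b k)" if "k \<in> P" for k
        using f(2) that b(3)[of k] span_mono[of "b k" "\<Union>k\<in>P. b k"] by blast
      then show "x \<in> span (\<Union>k\<in>P. b k)" unfolding f(1) by (rule span_sum)
    qed
    then have "dim (subspace_sum S P) \<le> dim (\<Union>k\<in>P. b k)" by (metis dim_span dim_subset)
    with assms(3)[OF that] show ?thesis by simp
  qed
  from rado_independent_transversal[OF assms(1) b(1) this]
  obtain v where "\<forall>k\<in>U. v k \<in> b k" "inj_on v U" "independent (v ` U)" by blast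
  with b(2) show ?thesis by (meson subsetD)
qed

text \<open>The easy converse of Rado's theorem: the transversal itself supplies
  \<open>card P\<close> independent vectors in the sum.\<close>

lemma card_le_dim_subspace_sum:
  fixes S :: "'k \<Rightarrow> 'a::euclidean_space set"
  assumes "finite P" and S: "\<And>k. k \<in> P \<Longrightarrow> subspace (S k)" and v: "\<And>k. k \<in> P \<Longrightarrow> v k \<in> S k"
    and "inj_on v P" and "independent (v ` P)"
  shows "card P \<le> dim (subspace_sum S P)"
proof -
  have "v k \<in> subspace_sum S P" if k: "k \<in> P" for k
    unfolding subspace_sum_def
    by (rule CollectI, rule exI[of _ "\<lambda>l. if l = k then v k else 0"])
      (use k v S assms(1) in \<open>auto simp: subspace_0\<close>)
  then have "card (v ` P) \<le> dim (subspace_sum S P)"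
    using assms(5) by (intro independent_card_le_dim) auto
  with assms(4) show ?thesis by (simp add: card_image)
qed

text \<open>Turns an inclusion of eigenvalue multisets into a pairing of the indices that carry
  them. Each \<open>s\<close> is paired with some \<open>t\<close> of equal value, which is then
  removed from \<open>T\<close>.\<close>

lemma inj_on_of_image_mset_subset:
  assumes "finite S" "finite T" and "image_mset f (mset_set S) \<subseteq># image_mset g (mset_set T)"
  shows "\<exists>h. inj_on h S \<and> h ` S \<subseteq> T \<and> (\<forall>s\<in>S. g (h s) = f s)"
  using assms
proof (induction S arbitrary: T rule: finite_induct)
  case empty
  then show ?case by simp
next
  case (insert s S)
  have "f s \<in># image_mset f (mset_set (insert s S))" using insert by simp
  then have "f s \<in># image_mset g (mset_set T)" using insert.prems(2) by (meson mset_subset_eqD)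
  then obtain t where t: "t \<in> T" "g t = f s" using insert by auto
  have T: "mset_set T = add_mset t (mset_set (T - {t}))"
    using t insert.prems(1) by (simp add: mset_set.remove)
  have "image_mset f (mset_set S) \<subseteq># image_mset g (mset_set (T - {t}))"
    using insert t unfolding T by simp
  then obtain h where h: "inj_on h S" "h ` S \<subseteq> T - {t}" "\<forall>s\<in>S. g (h s) = f s"
    using insert.IH[of "T - {t}"] insert.prems(1) by auto
  show ?case
    by (rule exI[of _ "h(s := t)"]) (use h t insert.hyps in \<open>auto simp: inj_on_def\<close>)
qed

section \<open>Matrices with a real eigenbasis\<close>

text \<open>The index set is abstract because the locale serves both the modes of a decoupling
  eigenbasis and the transversal found by Rado's theorem.\<close>

locale real_eigenbasis =
  fixes M :: "real^'n^'n" and W :: "'k set" and v :: "'k \<Rightarrow> real^'n" and \<mu> :: "'k \<Rightarrow> real"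
  assumes finite_W: "finite W" and inj_v: "inj_on v W" and indep_v: "independent (v ` W)"
    and span_v: "span (v ` W) = UNIV" and eigen: "\<And>k. k \<in> W \<Longrightarrow> M *v v k = \<mu> k *\<^sub>R v k"
begin

definition coord :: "'k \<Rightarrow> real^'n \<Rightarrow> real" where
  "coord k x = representation (v ` W) x (v k)"

lemma linear_coord: "linear (coord k)"
  by (rule linearI) (simp_all add: coord_def representation_add representation_scale indep_v span_v)

lemma bounded_linear_coord: "bounded_linear (coord k)"
  using linear_coord by (simp add: linear_conv_bounded_linear)

lemma coord_expansion: "(\<Sum>k\<in>W. coord k x *\<^sub>R v k) = x"
proof -
  have "(\<Sum>b\<in>v ` W. representation (v ` W) x b *\<^sub>R b) = x"
    by (rule sum_representation_eq) (auto simp: indep_v span_v finite_W)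
  then show ?thesis by (simp add: sum.reindex inj_v coord_def)
qed

lemma coord_v: "k \<in> W \<Longrightarrow> l \<in> W \<Longrightarrow> coord k (v l) = (if k = l then 1 else 0)"
  using inj_v by (auto simp: coord_def representation_basis indep_v inj_on_eq_iff)

lemma coord_eq_0: "(\<And>k. k \<in> W \<Longrightarrow> coord k x = 0) \<Longrightarrow> x = 0"
  using coord_expansion[of x] by simp

lemma coord_sum: "k \<in> W \<Longrightarrow> coord k (\<Sum>l\<in>W. a l *\<^sub>R v l) = a k"
  using linear_sum[OF linear_coord, of k "\<lambda>l. a l *\<^sub>R v l" W] finite_W
  by (simp add: linear_scale[OF linear_coord] coord_v if_distrib cong: if_cong)

lemma mult_sum_v: "M *v (\<Sum>k\<in>W. a k *\<^sub>R v k) = (\<Sum>k\<in>W. (\<mu> k * a k) *\<^sub>R v k)"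
  by (simp add: linear_sum[OF matrix_vector_mul_linear] eigen
      linear_scale[OF matrix_vector_mul_linear] mult.commute)

text \<open>Each coordinate functional is a left eigenvector of \<open>M\<close>; this splits the
  time evolutions and the eigenvalue equation into scalar equations.\<close>

lemma coord_mult: "k \<in> W \<Longrightarrow> coord k (M *v x) = \<mu> k * coord k x"
  using coord_sum[of k "\<lambda>k. \<mu> k * coord k x"] mult_sum_v[of "\<lambda>k. coord k x"]
  by (simp add: coord_expansion)

text \<open>The eigenvectors in \<open>spectrum\<close> are complex while the basis is real, so the
  eigenvalue equation is split into real and imaginary parts before coordinates are taken. If
  \<open>z\<close> is none of the \<open>\<mu> k\<close>, all coordinates of both parts
  vanish.\<close>

lemma spectrum_subset: "spectrum M \<subseteq> complex_of_real ` \<mu> ` W"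
proof
  fix z assume "z \<in> spectrum M"
  then obtain x where x: "x \<noteq> 0" "map_matrix complex_of_real M *v x = z *s x"
    by (auto simp: spectrum_def)
  define a where "a = (\<chi> i. Re (x $ i))"
  define b where "b = (\<chi> i. Im (x $ i))"
  have Re: "M *v a = Re z *\<^sub>R a - Im z *\<^sub>R b"
  proof (rule vec_eq_iff[THEN iffD2, rule_format])
    fix i
    have "Re ((map_matrix complex_of_real M *v x) $ i) = Re ((z *s x) $ i)" by (simp add: x)
    then show "(M *v a) $ i = (Re z *\<^sub>R a - Im z *\<^sub>R b) $ i"
      by (simp add: matrix_vector_mult_def map_matrix_def a_def b_def)
  qed
  have Im: "M *v b = Im z *\<^sub>R a + Re z *\<^sub>R b"
  proof (rule vec_eq_iff[THEN iffD2, rule_format])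
    fix i
    have "Im ((map_matrix complex_of_real M *v x) $ i) = Im ((z *s x) $ i)" by (simp add: x)
    then show "(M *v b) $ i = (Im z *\<^sub>R a + Re z *\<^sub>R b) $ i"
      by (simp add: matrix_vector_mult_def map_matrix_def a_def b_def)
  qed
  show "z \<in> complex_of_real ` \<mu> ` W"
  proof (rule ccontr)
    assume z: "z \<notin> complex_of_real ` \<mu> ` W"
    have "coord k a = 0 \<and> coord k b = 0" if k: "k \<in> W" for k
    proof -
      \<comment> \<open>The complex \<open>k\<close>-th coordinate of \<open>x\<close>, for which
        the two real equations recombine into one.\<close>
      define c where "c = Complex (coord k a) (coord k b)"
      have "\<mu> k * coord k a = Re z * coord k a - Im z * coord k b"
        using coord_mult[OF k, of a] unfolding Re
        by (simp add: linear_diff[OF linear_coord] linear_scale[OF linear_coord])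
      moreover have "\<mu> k * coord k b = Im z * coord k a + Re z * coord k b"
        using coord_mult[OF k, of b] unfolding Im
        by (simp add: linear_add[OF linear_coord] linear_scale[OF linear_coord])
      ultimately have "of_real (\<mu> k) * c = z * c"
        by (simp add: c_def complex_eq_iff)
      moreover have "of_real (\<mu> k) \<noteq> z" using z k by auto
      ultimately have "c = 0" by simp
      then show ?thesis by (simp add: c_def complex_eq_iff)
    qed
    then have "a = 0" "b = 0" by (auto intro: coord_eq_0)
    then have "x = 0" by (simp add: a_def b_def vec_eq_iff complex_eq_iff)
    with x show False by simp
  qed
qed

text \<open>On coordinate \<open>k\<close> the matrix acts as the nonzero factor
  \<open>d - \<mu> k\<close>. For \<open>d = dc_point td\<close> this makes the
  \<open>matrix_inv\<close> in the static gain a true inverse.\<close>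

lemma inj_shifted:
  assumes "d \<notin> \<mu> ` W"
  shows "inj ((*v) (d *\<^sub>R mat 1 - M))"
proof -
  have "x = 0" if "(d *\<^sub>R mat 1 - M) *v x = 0" for x
  proof (rule coord_eq_0)
    fix k assume k: "k \<in> W"
    have "M *v x = d *\<^sub>R x"
      using that by (simp add: matrix_vector_mult_diff_rdistrib scaleR_matrix_vector_assoc[symmetric])
    with coord_mult[OF k, of x] have "\<mu> k * coord k x = d * coord k x"
      by (simp only: linear_scale[OF linear_coord] real_scaleR_def)
    moreover have "\<mu> k \<noteq> d" using assms k by auto
    ultimately show "coord k x = 0" by simp
  qed
  then show ?thesis by (simp add: linear_injective_0[OF matrix_vector_mul_linear])
qed

text \<open>Uniqueness by an integrating factor: \<open>g\<close> has derivative zero on the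
  half-line, so it keeps its initial value.\<close>

lemma ct_solution_coord:
  assumes "ct_solution M (\<lambda>_. 0) x" and "k \<in> W" and "0 \<le> t"
  shows "coord k (x t) = coord k (x 0) * exp (\<mu> k * t)"
proof -
  define g where "g t = coord k (x t) * exp (- \<mu> k * t)" for t
  have "(g has_vector_derivative 0) (at t within {0..})" if "t \<in> {0..}" for t
  proof -
    have "(x has_vector_derivative M *v x t) (at t within {0..})"
      using assms(1) that by (simp add: ct_solution_def)
    from bounded_linear.has_vector_derivative[OF bounded_linear_coord[of k] this] assms(2)
    have "((\<lambda>t. coord k (x t)) has_real_derivative \<mu> k * coord k (x t)) (at t within {0..})"
      by (simp add: coord_mult has_real_derivative_iff_has_vector_derivative)
    then have "(g has_real_derivative 0) (at t within {0..})"
      unfolding g_def by (auto intro!: derivative_eq_intros)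
    then show ?thesis by (simp add: has_real_derivative_iff_has_vector_derivative)
  qed
  then obtain c where "\<And>t. t \<in> {0..} \<Longrightarrow> g t = c"
    using has_vector_derivative_zero_constant[of "{0..}" g] by auto
  then have "g t = g 0" using assms(3) by simp
  then show ?thesis by (simp add: g_def exp_minus field_simps)
qed

text \<open>Superposed eigenmodes with free coefficients, from which arbitrary output coefficients
  are realised later.\<close>

lemma ct_solution_sum:
  "ct_solution M (\<lambda>_. 0) (\<lambda>t. \<Sum>k\<in>W. (a k * exp (\<mu> k * t)) *\<^sub>R v k)"
  unfolding ct_solution_def
proof (intro allI impI)
  fix t :: real
  have "((\<lambda>t. \<Sum>k\<in>W. (a k * exp (\<mu> k * t)) *\<^sub>R v k) has_vector_derivative
      (\<Sum>k\<in>W. (\<mu> k * (a k * exp (\<mu> k * t))) *\<^sub>R v k)) (at t within {0..})"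
  proof (rule has_vector_derivative_sum)
    fix k
    have "((\<lambda>t. a k * exp (\<mu> k * t)) has_real_derivative \<mu> k * (a k * exp (\<mu> k * t))) (at t within {0..})"
      by (auto intro!: derivative_eq_intros)
    then show "((\<lambda>t. (a k * exp (\<mu> k * t)) *\<^sub>R v k) has_vector_derivative
        (\<mu> k * (a k * exp (\<mu> k * t))) *\<^sub>R v k) (at t within {0..})"
      by (auto intro!: derivative_eq_intros)
  qed
  then show "((\<lambda>t. \<Sum>k\<in>W. (a k * exp (\<mu> k * t)) *\<^sub>R v k) has_vector_derivative
      M *v (\<Sum>k\<in>W. (a k * exp (\<mu> k * t)) *\<^sub>R v k) + 0) (at t within {0..})"
    by (simp add: mult_sum_v)
qed

lemma dt_solution_coord:
  assumes "dt_solution M (\<lambda>_. 0) x" and "k \<in> W"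
  shows "coord k (x t) = coord k (x 0) * \<mu> k ^ t"
  using assms by (induction t) (simp_all add: dt_solution_def coord_mult)

lemma dt_solution_sum:
  "dt_solution M (\<lambda>_. 0) (\<lambda>t. \<Sum>k\<in>W. (a k * \<mu> k ^ t) *\<^sub>R v k)"
  by (simp add: dt_solution_def mult_sum_v mult.left_commute)

lemma ct_solution_tendsto_0:
  assumes "ct_solution M (\<lambda>_. 0) x" and "\<And>k. k \<in> W \<Longrightarrow> \<mu> k < 0"
  shows "(x \<longlongrightarrow> 0) at_top"
proof -
  have "((\<lambda>t. \<Sum>k\<in>W. (coord k (x 0) * exp (\<mu> k * t)) *\<^sub>R v k) \<longlongrightarrow>
      (\<Sum>k\<in>W. (coord k (x 0) * 0) *\<^sub>R v k)) at_top"
  proof (intro tendsto_intros)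
    fix k assume "k \<in> W"
    then have "filterlim (\<lambda>t. \<mu> k * t) at_bot at_top"
      using assms(2) by (intro filterlim_tendsto_neg_mult_at_bot[OF tendsto_const _ filterlim_ident])
    then show "((\<lambda>t. exp (\<mu> k * t)) \<longlongrightarrow> 0) at_top"
      by (rule filterlim_compose[OF exp_at_bot])
  qed
  \<comment> \<open>The modal formula describes \<open>x t\<close> only for
    \<open>t \<ge> 0\<close>, which suffices for a limit at infinity.\<close>
  moreover have "\<forall>\<^sub>F t in at_top. (\<Sum>k\<in>W. (coord k (x 0) * exp (\<mu> k * t)) *\<^sub>R v k) = x t"
    using eventually_ge_at_top[of 0]
  proof eventually_elim
    case (elim t)
    then show ?case
      using coord_expansion[of "x t"] ct_solution_coord[OF assms(1) _ elim]
      by (metis (no_types, lifting) sum.cong)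
  qed
  ultimately show ?thesis by (simp add: tendsto_cong)
qed

lemma dt_solution_tendsto_0:
  assumes "dt_solution M (\<lambda>_. 0) x" and "\<And>k. k \<in> W \<Longrightarrow> \<bar>\<mu> k\<bar> < 1"
  shows "x \<longlonglongrightarrow> 0"
proof -
  have "(\<lambda>t. \<Sum>k\<in>W. (coord k (x 0) * \<mu> k ^ t) *\<^sub>R v k) \<longlonglongrightarrow>
      (\<Sum>k\<in>W. (coord k (x 0) * 0) *\<^sub>R v k)"
    by (intro tendsto_intros LIMSEQ_power_zero) (simp add: assms(2))
  moreover have "(\<Sum>k\<in>W. (coord k (x 0) * \<mu> k ^ t) *\<^sub>R v k) = x t" for t
    using coord_expansion[of "x t"] dt_solution_coord[OF assms(1), of _ t]
    by (metis (no_types, lifting) sum.cong)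
  ultimately show ?thesis by simp
qed

end

section \<open>Decoupled responses and the static gain\<close>

lemma finite_mode_indices: "finite (mode_indices (\<nu> :: 'p::finite option \<Rightarrow> nat))"
  by (simp add: mode_indices_def)

lemma decoupling_eigenbasis_imp_real_eigenbasis:
  assumes "decoupling_eigenbasis A B C D F \<nu> \<mu> v"
  shows "real_eigenbasis (A + B ** F) (mode_indices \<nu>) (\<lambda>(i, j). v i j) (\<lambda>(i, j). \<mu> i j)"
  using assms by unfold_locales (auto simp: decoupling_eigenbasis_def finite_mode_indices)

text \<open>Component \<open>q\<close> of \<open>axis i 1\<close> is zero for
  \<open>i \<noteq> q\<close>, and \<open>N\<close> annihilates the \<open>None\<close> modes, so
  the sum over all modes collapses to those of output \<open>q\<close>.\<close>

lemma decoupled_output: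
  fixes N :: "real^'n^'p"
  assumes "\<And>j. j \<in> {1..\<nu> None} \<Longrightarrow> N *v v None j = 0"
    and "\<And>i j. j \<in> {1..\<nu> (Some i)} \<Longrightarrow> N *v v (Some i) j = c i j *\<^sub>R axis i 1"
  shows "(N *v (\<Sum>k\<in>mode_indices \<nu>. a k *\<^sub>R (case k of (i, j) \<Rightarrow> v i j))) $ q =
    (\<Sum>j = 1..\<nu> (Some q). a (Some q, j) * c q j)"
proof -
  have "(N *v (\<Sum>k\<in>mode_indices \<nu>. a k *\<^sub>R (case k of (i, j) \<Rightarrow> v i j))) $ q =
      (\<Sum>(i, j)\<in>mode_indices \<nu>. a (i, j) * (N *v v i j) $ q)"
    by (simp add: linear_sum[OF matrix_vector_mul_linear] linear_scale[OF matrix_vector_mul_linear]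
        case_prod_beta)
  also have "\<dots> = (\<Sum>i\<in>UNIV. \<Sum>j = 1..\<nu> i. a (i, j) * (N *v v i j) $ q)"
    unfolding mode_indices_def by (subst sum.Sigma) auto
  also have "\<dots> = (\<Sum>i\<in>UNIV. \<Sum>j = 1..\<nu> (Some i). a (Some i, j) * (N *v v (Some i) j) $ q)"
    using assms(1) by (simp add: UNIV_option_conv sum.reindex)
  also have "\<dots> = (\<Sum>i\<in>UNIV. if i = q then \<Sum>j = 1..\<nu> (Some q). a (Some q, j) * c q j else 0)"
    using assms(2) by (intro sum.cong refl) (auto simp: axis_def)
  finally show ?thesis by simp
qed

text \<open>Modal coordinates evolve separately, so an initial coordinate times the gain
  \<open>c\<close> of its mode is a response coefficient. As the gains are nonzero, every
  \<open>\<beta>\<close> is reached.\<close>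

lemma decoupled_responses_of_eigenbasis:
  fixes A :: "real^'n^'n" and B :: "real^'m^'n" and C :: "real^'n^'p" and D :: "real^'m^'p"
  assumes "decoupling_eigenbasis A B C D F \<nu> \<mu> v"
  shows "decoupled_responses td A B C D F \<nu> \<mu>"
proof -
  interpret real_eigenbasis "A + B ** F" "mode_indices \<nu>" "\<lambda>(i, j). v i j" "\<lambda>(i, j). \<mu> i j"
    using assms by (rule decoupling_eigenbasis_imp_real_eigenbasis)
  have "\<forall>i j. \<exists>c. j \<in> {1..\<nu> (Some i)} \<longrightarrow> c \<noteq> 0 \<and> (C + D ** F) *v v (Some i) j = c *\<^sub>R axis i 1"
    using assms by (auto simp: decoupling_eigenbasis_def)
  then obtain c where c: "\<And>i j. j \<in> {1..\<nu> (Some i)} \<Longrightarrow> c i j \<noteq> 0"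
      "\<And>i j. j \<in> {1..\<nu> (Some i)} \<Longrightarrow> (C + D ** F) *v v (Some i) j = c i j *\<^sub>R axis i 1"
    by metis
  have out: "((C + D ** F) *v (\<Sum>k\<in>mode_indices \<nu>. a k *\<^sub>R (case k of (i, j) \<Rightarrow> v i j))) $ q =
      (\<Sum>j = 1..\<nu> (Some q). a (Some q, j) * c q j)" for a q
    using assms c(2) by (intro decoupled_output) (auto simp: decoupling_eigenbasis_def)
  have mem: "(Some q, j) \<in> mode_indices \<nu> \<longleftrightarrow> j \<in> {1..\<nu> (Some q)}" for q j
    by (simp add: mode_indices_def)
  show ?thesis
  proof (cases td)
    case Continuous
    have "\<exists>\<beta>. \<forall>t\<ge>0. \<forall>i. ((C + D ** F) *v \<xi> t) $ i = (\<Sum>j = 1..\<nu> (Some i). \<beta> i j * exp (\<mu> (Some i) j * t))"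
      if "ct_solution (A + B ** F) (\<lambda>_. 0) \<xi>" for \<xi>
    proof (intro exI allI impI)
      fix t :: real and q assume t: "0 \<le> t"
      have "((C + D ** F) *v \<xi> t) $ q = (\<Sum>j = 1..\<nu> (Some q). coord (Some q, j) (\<xi> t) * c q j)"
        using out[of "\<lambda>k. coord k (\<xi> t)" q] by (simp only: coord_expansion)
      also have "\<dots> = (\<Sum>j = 1..\<nu> (Some q). (coord (Some q, j) (\<xi> 0) * c q j) * exp (\<mu> (Some q) j * t))"
      proof (rule sum.cong)
        fix j assume "j \<in> {1..\<nu> (Some q)}"
        then show "coord (Some q, j) (\<xi> t) * c q j =
            (coord (Some q, j) (\<xi> 0) * c q j) * exp (\<mu> (Some q) j * t)"
          using ct_solution_coord[OF that _ t, of "(Some q, j)"] by (simp add: mem)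
      qed simp
      finally show "((C + D ** F) *v \<xi> t) $ q =
        (\<Sum>j = 1..\<nu> (Some q). (coord (Some q, j) (\<xi> 0) * c q j) * exp (\<mu> (Some q) j * t))" .
    qed
    moreover have "\<exists>\<xi>. ct_solution (A + B ** F) (\<lambda>_. 0) \<xi> \<and>
      (\<forall>t\<ge>0. \<forall>i. ((C + D ** F) *v \<xi> t) $ i = (\<Sum>j = 1..\<nu> (Some i). \<beta> i j * exp (\<mu> (Some i) j * t)))" for \<beta>
    proof (intro exI conjI allI impI)
      \<comment> \<open>Dividing by the gain cancels the factor that \<open>out\<close> puts in; the
        unobservable modes leave no trace in the output and start at zero.\<close>
      define a where "a = (\<lambda>(i, j). case i of Some q \<Rightarrow> \<beta> q j / c q j | None \<Rightarrow> 0)"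
      let ?\<xi> = "\<lambda>t. \<Sum>k\<in>mode_indices \<nu>. (a k * exp ((case k of (i, j) \<Rightarrow> \<mu> i j) * t)) *\<^sub>R (case k of (i, j) \<Rightarrow> v i j)"
      show "ct_solution (A + B ** F) (\<lambda>_. 0) ?\<xi>" by (rule ct_solution_sum)
      fix t :: real and q
      show "((C + D ** F) *v ?\<xi> t) $ q = (\<Sum>j = 1..\<nu> (Some q). \<beta> q j * exp (\<mu> (Some q) j * t))"
        unfolding out using c(1) by (intro sum.cong refl) (simp add: a_def)
    qed
    ultimately show ?thesis by (simp add: decoupled_responses_def Continuous)
  next
    case Discrete
    have "\<exists>\<beta>. \<forall>t. \<forall>i. ((C + D ** F) *v \<xi> t) $ i = (\<Sum>j = 1..\<nu> (Some i). \<beta> i j * \<mu> (Some i) j ^ t)"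
      if "dt_solution (A + B ** F) (\<lambda>_. 0) \<xi>" for \<xi>
    proof (intro exI allI)
      fix t q
      have "((C + D ** F) *v \<xi> t) $ q = (\<Sum>j = 1..\<nu> (Some q). coord (Some q, j) (\<xi> t) * c q j)"
        using out[of "\<lambda>k. coord k (\<xi> t)" q] by (simp only: coord_expansion)
      also have "\<dots> = (\<Sum>j = 1..\<nu> (Some q). (coord (Some q, j) (\<xi> 0) * c q j) * \<mu> (Some q) j ^ t)"
      proof (rule sum.cong)
        fix j assume "j \<in> {1..\<nu> (Some q)}"
        then show "coord (Some q, j) (\<xi> t) * c q j =
            (coord (Some q, j) (\<xi> 0) * c q j) * \<mu> (Some q) j ^ t"
          using dt_solution_coord[OF that, of "(Some q, j)" t] by (simp add: mem)
      qed simp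
      finally show "((C + D ** F) *v \<xi> t) $ q =
        (\<Sum>j = 1..\<nu> (Some q). (coord (Some q, j) (\<xi> 0) * c q j) * \<mu> (Some q) j ^ t)" .
    qed
    moreover have "\<exists>\<xi>. dt_solution (A + B ** F) (\<lambda>_. 0) \<xi> \<and>
      (\<forall>t. \<forall>i. ((C + D ** F) *v \<xi> t) $ i = (\<Sum>j = 1..\<nu> (Some i). \<beta> i j * \<mu> (Some i) j ^ t))" for \<beta>
    proof (intro exI conjI allI)
      define a where "a = (\<lambda>(i, j). case i of Some q \<Rightarrow> \<beta> q j / c q j | None \<Rightarrow> 0)"
      let ?\<xi> = "\<lambda>t. \<Sum>k\<in>mode_indices \<nu>. (a k * (case k of (i, j) \<Rightarrow> \<mu> i j) ^ t) *\<^sub>R (case k of (i, j) \<Rightarrow> v i j)"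
      show "dt_solution (A + B ** F) (\<lambda>_. 0) ?\<xi>" by (rule dt_solution_sum)
      fix t q
      show "((C + D ** F) *v ?\<xi> t) $ q = (\<Sum>j = 1..\<nu> (Some q). \<beta> q j * \<mu> (Some q) j ^ t)"
        unfolding out using c(1) by (intro sum.cong refl) (simp add: a_def)
    qed
    ultimately show ?thesis by (simp add: decoupled_responses_def Discrete)
  qed
qed

section \<open>Full row rank of the pencil and surjectivity of the static gain\<close>

lemma rank_le_card_rows: "rank (A :: 'a::field^'n^'m) \<le> CARD('m)"
proof -
  have "rows A = range (\<lambda>i. row i A)" by (auto simp: rows_def)
  then have "finite (rows A)" "card (rows A) \<le> CARD('m)" by (auto intro: card_image_le)
  then show ?thesis unfolding row_rank_def_gen by (meson vec.dim_le_card' le_trans)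
qed

text \<open>\<open>rows A\<close> is a set and would merge equal rows, so counting first shows that
  the rows are distinct. Independence of the set then gives independence of the family, hence a
  right inverse.\<close>

lemma surj_of_full_row_rank:
  fixes A :: "'a::field^'n^'m"
  assumes "rank A = CARD('m)"
  shows "surj ((*v) A)"
proof -
  have rows: "rows A = range (\<lambda>i. row i A)" by (auto simp: rows_def)
  then have fin: "finite (rows A)" and le: "card (rows A) \<le> CARD('m)" by (auto intro: card_image_le)
  have dim: "vec.dim (rows A) = CARD('m)" using assms by (simp add: row_rank_def_gen)
  then have "card (rows A) = CARD('m)" using le vec.dim_le_card'[OF fin] by simp
  then have inj: "inj (\<lambda>i. row i A)" by (simp add: rows eq_card_imp_inj_on)
  have indep: "vec.independent (rows A)"
    using vec.card_le_dim_spanning[OF order_refl vec.span_superset fin] le dim by simp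
  have "c i = 0" if "(\<Sum>i\<in>UNIV. c i *s row i A) = 0" for c i
  proof -
    \<comment> \<open>Recovers the index from the row, so that coefficients on indices become
      coefficients on vectors.\<close>
    define g where "g = inv (\<lambda>i. row i A)"
    have g: "g (row i A) = i" for i unfolding g_def by (rule inv_f_f[OF inj])
    have "(\<Sum>b\<in>rows A. c (g b) *s b) = 0"
      using that by (simp add: rows sum.reindex inj g)
    then have "c (g (row i A)) = 0"
      using indep fin vec.independentD[of "rows A" "rows A" "\<lambda>b. c (g b)" "row i A"] by (auto simp: rows)
    then show ?thesis by (simp add: g)
  qed
  then show ?thesis
    by (simp add: matrix_right_invertible_surjective[symmetric] matrix_right_invertible_independent_rows)
qed

text \<open>Only finitely many points lack full row rank and the complex plane is infinite, so full
  rank occurs somewhere and the normal rank is at least \<open>CARD('n + 'p)\<close>. A point that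
  is not an invariant zero attains it.\<close>

lemma full_row_rank_pencil:
  fixes A :: "real^'n^'n" and B :: "real^'m^'n" and C :: "real^'n^'p" and D :: "real^'m^'p"
  assumes "right_invertible A B C D" and "\<not> invariant_zero A B C D z"
  shows "rank (eval_at (pencil A B C D) z) = CARD('n + 'p)"
proof -
  let ?r = "\<lambda>z. rank (eval_at (pencil A B C D) z)"
  have "\<not> UNIV \<subseteq> {z. ?r z \<noteq> CARD('n) + CARD('p)}"
    using assms(1) infinite_UNIV_char_0[where 'a = complex] finite_subset
    unfolding right_invertible_def by blast
  then obtain z0 where z0: "?r z0 = CARD('n + 'p)" by auto
  \<comment> \<open>The row count bounds all ranks, which makes the \<open>Max\<close> in
    \<open>normal_rank\<close> one over a finite set.\<close>
  have "range ?r \<subseteq> {..CARD('n + 'p)}" by (rule image_subsetI) (simp only: atMost_iff rank_le_card_rows)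
  then have "finite (range ?r)" by (rule finite_subset) simp
  then have "?r z0 \<le> normal_rank (pencil A B C D)"
    unfolding normal_rank_def by (intro Max_ge) auto
  moreover have "normal_rank (pencil A B C D) \<le> ?r z" using assms(2) by (simp add: invariant_zero_def)
  moreover have "?r z \<le> CARD('n + 'p)" by (rule rank_le_card_rows)
  ultimately show ?thesis using z0 by linarith
qed

text \<open>At a real point the pencil has real entries, so the real part of a complex solution
  solves the real equations.\<close>

lemma real_pencil_solvable:
  fixes A :: "real^'n^'n" and B :: "real^'m^'n" and C :: "real^'n^'p" and D :: "real^'m^'p"
  assumes "right_invertible A B C D" and "\<not> invariant_zero A B C D (complex_of_real d)"
  shows "\<exists>v w. (A - d *\<^sub>R mat 1) *v v + B *v w = 0 \<and> C *v v + D *v w = y"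
proof -
  let ?E = "eval_at (pencil A B C D) (complex_of_real d)"
  define b :: "complex^('n + 'p)" where
    "b = (\<chi> r. case r of Inl i \<Rightarrow> 0 | Inr i \<Rightarrow> complex_of_real (y $ i))"
  obtain x where x: "?E *v x = b"
    using surj_of_full_row_rank[OF full_row_rank_pencil[OF assms]] by (metis surjD)
  define v where "v = (\<chi> j. Re (x $ Inl j))"
  define w where "w = (\<chi> j. Re (x $ Inr j))"
  have E: "(?E *v x) $ r = (\<Sum>j\<in>UNIV. ?E $ r $ Inl j * x $ Inl j) + (\<Sum>j\<in>UNIV. ?E $ r $ Inr j * x $ Inr j)" for r
    unfolding matrix_vector_mult_def
    by (simp add: UNIV_Plus_UNIV[symmetric] sum.Plus del: UNIV_Plus_UNIV)
  have "((A - d *\<^sub>R mat 1) *v v + B *v w) $ i = 0" for i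
  proof -
    have "Re ((?E *v x) $ Inl i) = 0" by (simp add: x b_def)
    moreover have "?E $ Inl i $ Inl j = complex_of_real ((A - d *\<^sub>R mat 1) $ i $ j)" for j
      by (simp add: eval_at_def map_matrix_def pencil_def mat_def)
    moreover have "?E $ Inl i $ Inr j = complex_of_real (B $ i $ j)" for j
      by (simp add: eval_at_def map_matrix_def pencil_def)
    ultimately show ?thesis unfolding E
      by (simp add: matrix_vector_mult_def v_def w_def del: vector_minus_component)
  qed
  moreover have "(C *v v + D *v w) $ i = y $ i" for i
  proof -
    have "Re ((?E *v x) $ Inr i) = y $ i" by (simp add: x b_def)
    then show ?thesis unfolding E
      by (simp add: eval_at_def map_matrix_def pencil_def matrix_vector_mult_def v_def w_def)
  qed
  ultimately show ?thesis by (metis vec_eq_iff zero_index)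
qed

lemma matrix_inv_mult_eq:
  fixes K :: "real^'n^'n"
  assumes "inj ((*v) K)"
  shows "matrix_inv K *v (K *v x) = x" and "K *v (matrix_inv K *v x) = x"
proof -
  have "invertible K"
    using assms by (simp add: invertible_left_inverse matrix_left_invertible_injective)
  then show "matrix_inv K *v (K *v x) = x" "K *v (matrix_inv K *v x) = x"
    unfolding invertible_def matrix_inv_def matrix_vector_mul_assoc
    by (smt (verit, ccfv_SIG) matrix_vector_mul_lid someI_ex)+
qed

text \<open>The pencil at the constant frequency yields a steady state \<open>v\<close> and a plant
  input \<open>w\<close> with output \<open>y\<close>. The feedback contributes
  \<open>F *v v\<close> to \<open>w\<close>; the rest is the external input sought.\<close>

lemma surj_static_gain:
  fixes A :: "real^'n^'n" and B :: "real^'m^'n" and C :: "real^'n^'p" and D :: "real^'m^'p"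
  assumes "right_invertible A B C D" and "\<not> invariant_zero A B C D (complex_of_real (dc_point td))"
    and inj: "inj ((*v) (dc_point td *\<^sub>R mat 1 - (A + B ** F)))"
  shows "surj ((*v) (static_gain td A B C D F))"
proof -
  let ?K = "dc_point td *\<^sub>R mat 1 - (A + B ** F)"
  have "\<exists>u. y = static_gain td A B C D F *v u" for y
  proof -
    obtain v w where vw: "(A - dc_point td *\<^sub>R mat 1) *v v + B *v w = 0" "C *v v + D *v w = y"
      using real_pencil_solvable[OF assms(1,2)] by blast
    define u where "u = w - F *v v"
    have "dc_point td *\<^sub>R v = A *v v + B *v w"
      using vw(1) by (simp add: matrix_vector_mult_diff_rdistrib scaleR_matrix_vector_assoc[symmetric]
          algebra_simps)
    then have "?K *v v = (A *v v + B *v w) - (A *v v + B *v (F *v v))"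
      by (simp only: matrix_vector_mult_diff_rdistrib matrix_vector_mult_add_rdistrib
          matrix_vector_mul_assoc[symmetric] scaleR_matrix_vector_assoc[symmetric] matrix_vector_mul_lid)
    also have "\<dots> = B *v u"
      by (simp add: u_def matrix_vector_mult_diff_distrib)
    finally have "?K *v v = B *v u" .
    then have "v = matrix_inv ?K *v (B *v u)" by (metis matrix_inv_mult_eq(1)[OF inj])
    then have "static_gain td A B C D F *v u = (C + D ** F) *v v + D *v u"
      by (simp add: static_gain_def matrix_vector_mult_add_rdistrib matrix_vector_mul_assoc[symmetric])
    also have "\<dots> = y"
      unfolding vw(2)[symmetric]
      by (simp add: u_def matrix_vector_mult_add_rdistrib matrix_vector_mult_diff_distrib
          matrix_vector_mul_assoc)
    finally show ?thesis by (intro exI[of _ u]) simp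
  qed
  then show ?thesis by (auto simp: surj_def)
qed

section \<open>Tracking\<close>

lemma dc_point_not_stable: "complex_of_real (dc_point td) \<notin> stable_region td"
  by (cases td) (simp_all add: dc_point_def stable_region_def)

text \<open>Subtracting the equilibrium that belongs to the reference turns the closed loop into the
  homogeneous system, whose solutions decay. At the equilibrium the output is \<open>r\<close>, by
  the choice of \<open>G\<close>.\<close>

lemma tracks_constant_references_of_eigenbasis:
  fixes A :: "real^'n^'n" and B :: "real^'m^'n" and C :: "real^'n^'p" and D :: "real^'m^'p"
  assumes "real_eigenbasis (A + B ** F) W v \<mu>"
    and stable: "\<And>k. k \<in> W \<Longrightarrow> complex_of_real (\<mu> k) \<in> stable_region td"
    and G: "static_gain td A B C D F ** G = mat 1"
  shows "tracks_constant_references td A B C D F G"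
proof -
  interpret real_eigenbasis "A + B ** F" W v \<mu> by fact
  let ?M = "A + B ** F" and ?K = "dc_point td *\<^sub>R mat 1 - (A + B ** F)" and ?N = "C + D ** F"
  have inj: "inj ((*v) ?K)"
    using stable dc_point_not_stable[of td] by (intro inj_shifted) auto
  define x0 where "x0 r = matrix_inv ?K *v (B *v (G *v r))" for r
  have "?K *v x0 r = B *v (G *v r)" for r
    unfolding x0_def by (rule matrix_inv_mult_eq(2)[OF inj])
  then have equilibrium: "B *v (G *v r) = dc_point td *\<^sub>R x0 r - ?M *v x0 r" for r
    by (simp only: matrix_vector_mult_diff_rdistrib scaleR_matrix_vector_assoc[symmetric]
        matrix_vector_mul_lid)
  \<comment> \<open>The leftover \<open>dc_point td *\<^sub>R x0 r\<close> is zero in continuous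
    time and \<open>x0 r\<close> in discrete time, where it is absorbed into the shifted successor
    state.\<close>
  have state: "A *v x + B *v (F *v x + G *v r) = ?M *v (x - x0 r) + dc_point td *\<^sub>R x0 r" for x r
    by (simp add: equilibrium matrix_vector_right_distrib matrix_vector_mult_add_rdistrib
        matrix_vector_mul_assoc[symmetric] matrix_vector_mult_diff_distrib)
  have gain: "?N *v x0 r + D *v (G *v r) = r" for r
  proof -
    have "?N *v x0 r + D *v (G *v r) = static_gain td A B C D F *v (G *v r)"
      by (simp add: static_gain_def x0_def matrix_vector_mult_add_rdistrib
          matrix_vector_mul_assoc[symmetric])
    then show ?thesis by (simp add: matrix_vector_mul_assoc G)
  qed
  have error_eq: "C *v x + D *v (F *v x + G *v r) = ?N *v (x - x0 r) + r" for x r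
    using gain[of r] by (simp add: matrix_vector_right_distrib matrix_vector_mult_add_rdistrib
        matrix_vector_mul_assoc[symmetric] matrix_vector_mult_diff_distrib algebra_simps)
  have lim: "((\<lambda>t. ?N *v z t + r) \<longlongrightarrow> r) Q" if "(z \<longlongrightarrow> 0) Q" for z :: "'t \<Rightarrow> real^'n" and Q r
    using tendsto_add[OF bounded_linear.tendsto[OF matrix_vector_mul_bounded_linear[of ?N] that] tendsto_const[of r]]
    by simp
  show ?thesis
  proof (cases td)
    case Continuous
    have "((\<lambda>t. C *v x t + D *v (F *v x t + G *v r)) \<longlongrightarrow> r) at_top"
      if "ct_solution A (\<lambda>t. B *v (F *v x t + G *v r)) x" for x r
    proof -
      have "ct_solution ?M (\<lambda>_. 0) (\<lambda>t. x t - x0 r)"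
        unfolding ct_solution_def
      proof (intro allI impI)
        fix t :: real assume "0 \<le> t"
        then have "(x has_vector_derivative ?M *v (x t - x0 r)) (at t within {0..})"
          using that by (simp add: ct_solution_def state dc_point_def Continuous)
        from has_vector_derivative_diff[OF this has_vector_derivative_const[of "x0 r"]]
        show "((\<lambda>t. x t - x0 r) has_vector_derivative ?M *v (x t - x0 r) + 0) (at t within {0..})"
          by simp
      qed
      then have "((\<lambda>t. x t - x0 r) \<longlongrightarrow> 0) at_top"
        by (rule ct_solution_tendsto_0) (use stable in \<open>auto simp: stable_region_def Continuous\<close>)
      then show ?thesis unfolding error_eq by (rule lim)
    qed
    then show ?thesis by (simp add: tracks_constant_references_def Continuous)
  next
    case Discrete
    have "(\<lambda>t. C *v x t + D *v (F *v x t + G *v r)) \<longlonglongrightarrow> r"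
      if "dt_solution A (\<lambda>t. B *v (F *v x t + G *v r)) x" for x r
    proof -
      have "dt_solution ?M (\<lambda>_. 0) (\<lambda>t. x t - x0 r)"
        using that by (simp add: dt_solution_def state dc_point_def Discrete)
      then have "(\<lambda>t. x t - x0 r) \<longlonglongrightarrow> 0"
        by (rule dt_solution_tendsto_0) (use stable in \<open>auto simp: stable_region_def Discrete\<close>)
      then show ?thesis unfolding error_eq by (rule lim)
    qed
    then show ?thesis by (simp add: tracks_constant_references_def Discrete)
  qed
qed

lemma exists_tracking_feedforward:
  fixes A :: "real^'n^'n" and B :: "real^'m^'n" and C :: "real^'n^'p" and D :: "real^'m^'p"
  assumes "right_invertible A B C D" and "\<not> invariant_zero A B C D (complex_of_real (dc_point td))"
    and "real_eigenbasis (A + B ** F) W v \<mu>"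
    and stable: "\<And>k. k \<in> W \<Longrightarrow> complex_of_real (\<mu> k) \<in> stable_region td"
  shows "spectrum (A + B ** F) \<subseteq> stable_region td \<and>
    (\<exists>G. static_gain td A B C D F ** G = mat 1 \<and> tracks_constant_references td A B C D F G)"
proof -
  interpret real_eigenbasis "A + B ** F" W v \<mu> by fact
  have "inj ((*v) (dc_point td *\<^sub>R mat 1 - (A + B ** F)))"
    using stable dc_point_not_stable[of td] by (intro inj_shifted) auto
  then have "surj ((*v) (static_gain td A B C D F))" by (rule surj_static_gain[OF assms(1,2)])
  then obtain G where "static_gain td A B C D F ** G = mat 1"
    by (metis matrix_right_invertible_surjective)
  with tracks_constant_references_of_eigenbasis[OF assms(3) stable this] spectrum_subset stable
  show ?thesis by blast
qed

section \<open>The spaces \<open>R_space\<close> and closed-loop eigenvectors\<close>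

lemma subspace_R_space: "subspace (R_space A B C D i l)"
proof (unfold subspace_def, intro conjI ballI allI)
  show "0 \<in> R_space A B C D i l"
    by (auto simp: R_space_def intro!: exI[of _ 0])
next
  fix x y assume "x \<in> R_space A B C D i l" "y \<in> R_space A B C D i l"
  then obtain w z where "(A - l *\<^sub>R mat 1) *v x + B *v w = 0" "\<forall>k. i \<noteq> Some k \<longrightarrow> (C *v x + D *v w) $ k = 0"
    "(A - l *\<^sub>R mat 1) *v y + B *v z = 0" "\<forall>k. i \<noteq> Some k \<longrightarrow> (C *v y + D *v z) $ k = 0"
    unfolding R_space_def by blast
  then have "(A - l *\<^sub>R mat 1) *v (x + y) + B *v (w + z) = 0"
    "\<forall>k. i \<noteq> Some k \<longrightarrow> (C *v (x + y) + D *v (w + z)) $ k = 0"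
    by (simp_all add: matrix_vector_right_distrib eq_neg_iff_add_eq_0 add_ac)
      (metis (no_types, lifting) add.assoc add.left_commute add.right_neutral)+
  then show "x + y \<in> R_space A B C D i l" unfolding R_space_def by blast
next
  fix c :: real and x assume "x \<in> R_space A B C D i l"
  then obtain w where "(A - l *\<^sub>R mat 1) *v x + B *v w = 0" "\<forall>k. i \<noteq> Some k \<longrightarrow> (C *v x + D *v w) $ k = 0"
    unfolding R_space_def by blast
  moreover have "(A - l *\<^sub>R mat 1) *v (c *\<^sub>R x) + B *v (c *\<^sub>R w) = c *\<^sub>R ((A - l *\<^sub>R mat 1) *v x + B *v w)"
    "C *v (c *\<^sub>R x) + D *v (c *\<^sub>R w) = c *\<^sub>R (C *v x + D *v w)"
    by (simp_all only: matrix_vector_mult_scaleR scaleR_add_right)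
  ultimately show "c *\<^sub>R x \<in> R_space A B C D i l"
    unfolding R_space_def by (intro CollectI exI[of _ "c *\<^sub>R w"]) simp
qed

text \<open>The witness is the feedback input \<open>F *v v\<close>. Leaving \<open>i\<close> free
  matters: an unobservable eigenvector lies in the space of every output.\<close>

lemma closed_loop_eigenvector_in_R_space:
  assumes "(A + B ** F) *v v = l *\<^sub>R v"
    and "\<And>k. i \<noteq> Some k \<Longrightarrow> ((C + D ** F) *v v) $ k = 0"
  shows "v \<in> R_space A B C D i l"
  unfolding R_space_def
proof (intro CollectI exI[of _ "F *v v"] conjI allI impI)
  show "(A - l *\<^sub>R mat 1) *v v + B *v (F *v v) = 0"
    using assms(1) by (simp add: matrix_vector_mult_diff_rdistrib matrix_vector_mult_add_rdistrib
        matrix_vector_mul_assoc scaleR_matrix_vector_assoc[symmetric] algebra_simps)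
  show "(C *v v + D *v (F *v v)) $ k = 0" if "i \<noteq> Some k" for k
    using assms(2)[OF that] by (simp add: matrix_vector_mult_add_rdistrib matrix_vector_mul_assoc)
qed

section \<open>Modes and multisets of eigenvalues\<close>

lemma sum_image_mset_mset_set:
  assumes "finite I" and "\<And>i. i \<in> I \<Longrightarrow> finite (K i)"
    and "\<And>i j. i \<in> I \<Longrightarrow> j \<in> I \<Longrightarrow> i \<noteq> j \<Longrightarrow> K i \<inter> K j = {}"
  shows "(\<Sum>i\<in>I. image_mset f (mset_set (K i))) = image_mset f (mset_set (\<Union>i\<in>I. K i))"
  using assms
proof (induction I rule: finite_induct)
  case (insert i I)
  have "K i \<inter> (\<Union>j\<in>I. K j) = {}"
    using insert.prems(2) insert.hyps(2) by blast
  then show ?case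
    using insert by (simp add: mset_set_Union)
qed simp

lemma mode_indices_eq_Union: "mode_indices \<nu> = (\<Union>i. Pair i ` {1..\<nu> i})"
  by (auto simp: mode_indices_def)

text \<open>Tagging each mode with its output makes the index sets of different outputs disjoint, so
  that sums of modes become images of unions.\<close>

lemma modes_eq_image_mset: "modes \<nu> \<mu> i = image_mset (\<lambda>(i, j). \<mu> i j) (mset_set (Pair i ` {1..\<nu> i}))"
proof -
  have "mset_set (Pair i ` {1..\<nu> i}) = image_mset (Pair i) (mset_set {1..\<nu> i})"
    by (rule image_mset_mset_set[symmetric]) (simp add: inj_on_def)
  then show ?thesis by (simp add: modes_def multiset.map_comp comp_def)
qed

lemma sum_modes:
  fixes \<nu> :: "'p::finite option \<Rightarrow> nat"
  shows "(\<Sum>i\<in>UNIV. modes \<nu> \<mu> i) = image_mset (\<lambda>(i, j). \<mu> i j) (mset_set (mode_indices \<nu>))"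
  unfolding modes_eq_image_mset mode_indices_eq_Union by (rule sum_image_mset_mset_set) auto

text \<open>An assigned value that is not matched within its own output is unobservable: what the
  observable modes leave over of all the assigned values is exactly the unobservable modes.\<close>

lemma exists_mode_injection:
  fixes \<nu> \<nu>bar :: "'p::finite option \<Rightarrow> nat"
  assumes total: "(\<Sum>i\<in>UNIV. modes \<nu> \<mu> i) = (\<Sum>i\<in>UNIV. modes \<nu>bar lam i)"
    and sub: "\<And>i. modes \<nu> \<mu> (Some i) \<subseteq># modes \<nu>bar lam (Some i)"
  shows "\<exists>\<pi>. inj_on \<pi> (mode_indices \<nu>bar) \<and> \<pi> ` mode_indices \<nu>bar \<subseteq> mode_indices \<nu> \<and>
    (\<forall>k\<in>mode_indices \<nu>bar. \<mu> (fst (\<pi> k)) (snd (\<pi> k)) = lam (fst k) (snd k) \<and>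
       (fst (\<pi> k) = None \<or> fst (\<pi> k) = fst k))"
proof -
  let ?U = "mode_indices \<nu>bar"
  have "\<exists>h. inj_on h {1..\<nu> (Some i)} \<and> h ` {1..\<nu> (Some i)} \<subseteq> {1..\<nu>bar (Some i)} \<and>
      (\<forall>j\<in>{1..\<nu> (Some i)}. lam (Some i) (h j) = \<mu> (Some i) j)" for i
    using inj_on_of_image_mset_subset[OF _ _ sub[of i, unfolded modes_def]] by simp
  then obtain h where h: "\<And>i. inj_on (h i) {1..\<nu> (Some i)}"
      "\<And>i. h i ` {1..\<nu> (Some i)} \<subseteq> {1..\<nu>bar (Some i)}"
      "\<And>i j. j \<in> {1..\<nu> (Some i)} \<Longrightarrow> lam (Some i) (h i j) = \<mu> (Some i) j"
    by metis
  have h_in: "h i j \<in> {1..\<nu>bar (Some i)}" if "j \<in> {1..\<nu> (Some i)}" for i j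
    using h(2) that by blast
  define Obs where "Obs = (\<Union>i. Pair (Some i) ` {1..\<nu> (Some i)})"
  \<comment> \<open>Sends an observable mode to the assigned index paired with it in the same
    output. On \<open>Obs\<close> the first component is always a \<open>Some\<close>, so
    \<open>the\<close> is well defined there.\<close>
  define e where "e = (\<lambda>(i, j). (i, h (the i) j))"
  define H where "H = e ` Obs"
  have fin: "finite Obs" "finite ?U" by (simp_all add: Obs_def finite_mode_indices)
  have inj_e: "inj_on e Obs"
    using h(1) by (auto simp: inj_on_def Obs_def e_def)
  have H_sub: "H \<subseteq> ?U"
    using h_in by (auto simp: H_def Obs_def e_def mode_indices_def)
  have e_lam: "lam (fst (e k)) (snd (e k)) = \<mu> (fst k) (snd k)" if "k \<in> Obs" for k
    using that h(3) by (auto simp: Obs_def e_def)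
  have "image_mset (\<lambda>(i, j). lam i j) (mset_set H) = image_mset (\<lambda>(i, j). \<mu> i j) (mset_set Obs)"
    unfolding H_def image_mset_mset_set[OF inj_e, symmetric] multiset.map_comp
    using e_lam fin(1) by (intro image_mset_cong) (auto simp: comp_def case_prod_beta)
  moreover have "mset_set ?U = mset_set H + mset_set (?U - H)"
    using H_sub fin mset_set_Union[of H "?U - H"] finite_subset[OF H_sub]
    by (simp add: Un_absorb1)
  moreover have "mset_set (mode_indices \<nu>) = mset_set Obs + mset_set (Pair None ` {1..\<nu> None})"
  proof -
    have "mode_indices \<nu> = Obs \<union> Pair None ` {1..\<nu> None}"
      by (simp add: mode_indices_eq_Union Obs_def UNIV_option_conv Un_commute)
    moreover have "Obs \<inter> Pair None ` {1..\<nu> None} = {}" by (auto simp: Obs_def)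
    ultimately show ?thesis using fin(1) by (simp add: mset_set_Union)
  qed
  ultimately have "image_mset (\<lambda>(i, j). lam i j) (mset_set (?U - H)) = modes \<nu> \<mu> None"
    using total[unfolded sum_modes] by (simp add: modes_eq_image_mset)
  then obtain g where g: "inj_on g (?U - H)" "g ` (?U - H) \<subseteq> {1..\<nu> None}"
      "\<And>k. k \<in> ?U - H \<Longrightarrow> \<mu> None (g k) = lam (fst k) (snd k)"
    using inj_on_of_image_mset_subset[of "?U - H" "{1..\<nu> None}" "\<lambda>(i, j). lam i j" "\<mu> None"] fin(2)
    by (auto simp: modes_def case_prod_beta)
  \<comment> \<open>Paired indices go back to their observable mode; all others go to an
    unobservable mode of the same value.\<close>
  define \<pi> where "\<pi> k = (if k \<in> H then inv_into Obs e k else (None, g k))" for k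
  have inv: "inv_into Obs e k \<in> Obs" "e (inv_into Obs e k) = k" if "k \<in> H" for k
    using that unfolding H_def by (auto intro: inv_into_into f_inv_into_f)
  have Obs_mem: "fst k \<noteq> None" "k \<in> mode_indices \<nu>" "fst (e k) = fst k" if "k \<in> Obs" for k
    using that by (auto simp: Obs_def e_def mode_indices_def)
  \<comment> \<open>The first component tells the two branches of \<open>\<pi>\<close> apart, so
    injectivity can be checked on each branch alone.\<close>
  have \<pi>_None: "fst (\<pi> k) = None \<longleftrightarrow> k \<notin> H" for k
    using Obs_mem(1)[OF inv(1)] by (cases "k \<in> H") (simp_all add: \<pi>_def)
  show ?thesis
  proof (intro exI[of _ \<pi>] conjI ballI)
    show "inj_on \<pi> ?U"
    proof (rule inj_onI)
      fix k l assume kl: "k \<in> ?U" "l \<in> ?U" "\<pi> k = \<pi> l"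
      show "k = l"
      proof (cases "k \<in> H")
        case True
        moreover from this have "l \<in> H" using \<pi>_None kl(3) by metis
        ultimately show ?thesis using kl(3) inv(2) by (metis \<pi>_def)
      next
        case False
        moreover from this have "l \<notin> H" using \<pi>_None kl(3) by metis
        ultimately show ?thesis using kl g(1) by (simp add: \<pi>_def inj_on_eq_iff)
      qed
    qed
    show "\<pi> ` ?U \<subseteq> mode_indices \<nu>"
    proof (rule image_subsetI)
      fix k assume "k \<in> ?U"
      then have "k \<in> H \<or> g k \<in> {1..\<nu> None}" using g(2) by blast
      then show "\<pi> k \<in> mode_indices \<nu>"
        using Obs_mem(2)[OF inv(1)] by (cases "k \<in> H") (simp_all add: \<pi>_def mode_indices_def)
    qed
    fix k assume k: "k \<in> ?U"
    show "\<mu> (fst (\<pi> k)) (snd (\<pi> k)) = lam (fst k) (snd k)"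
      using k g(3) e_lam[OF inv(1)[of k]] inv(2)[of k] by (cases "k \<in> H") (simp_all add: \<pi>_def)
    show "fst (\<pi> k) = None \<or> fst (\<pi> k) = fst k"
      using Obs_mem(3)[OF inv(1)[of k]] inv(2)[of k] by (cases "k \<in> H") (simp_all add: \<pi>_def)
  qed
qed

section \<open>Necessity of the dimension inequalities\<close>

text \<open>Reindexed along \<open>\<pi>\<close>, the closed-loop eigenvectors form an independent
  transversal of the spaces attached to the assigned indices.\<close>

lemma dim_condition_of_eigenbasis:
  fixes A :: "real^'n^'n" and B :: "real^'m^'n" and C :: "real^'n^'p" and D :: "real^'m^'p"
  assumes basis: "decoupling_eigenbasis A B C D F \<nu> \<mu> v"
    and "(\<Sum>i\<in>UNIV. modes \<nu> \<mu> i) = (\<Sum>i\<in>UNIV. modes \<nu>bar lam i)"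
    and "\<And>i. modes \<nu> \<mu> (Some i) \<subseteq># modes \<nu>bar lam (Some i)"
    and P: "P \<subseteq> mode_indices \<nu>bar"
  shows "card P \<le> dim (subspace_sum (\<lambda>(i, j). R_space A B C D i (lam i j)) P)"
proof -
  let ?v = "\<lambda>(i, j). v i j"
  obtain \<pi> where inj: "inj_on \<pi> (mode_indices \<nu>bar)" and im: "\<pi> ` mode_indices \<nu>bar \<subseteq> mode_indices \<nu>"
    and \<pi>: "\<And>k. k \<in> mode_indices \<nu>bar \<Longrightarrow> \<mu> (fst (\<pi> k)) (snd (\<pi> k)) = lam (fst k) (snd k)"
      "\<And>k. k \<in> mode_indices \<nu>bar \<Longrightarrow> fst (\<pi> k) = None \<or> fst (\<pi> k) = fst k"
    using exists_mode_injection[OF assms(2,3)] by blast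
  have v: "inj_on ?v (mode_indices \<nu>)" "independent (?v ` mode_indices \<nu>)"
    using basis by (simp_all add: decoupling_eigenbasis_def)
  have observable: "\<forall>j\<in>{1..\<nu> (Some i)}. \<exists>c. c \<noteq> 0 \<and> (C + D ** F) *v v (Some i) j = c *\<^sub>R axis i 1" for i
    using basis unfolding decoupling_eigenbasis_def by blast
  show ?thesis
  proof (rule card_le_dim_subspace_sum)
    show "finite P" using P finite_mode_indices finite_subset by blast
    show "subspace (case k of (i, j) \<Rightarrow> R_space A B C D i (lam i j))" for k
      by (simp add: case_prod_beta subspace_R_space)
    have \<pi>P: "\<pi> ` P \<subseteq> mode_indices \<nu>" using P im by blast
    show "inj_on (?v \<circ> \<pi>) P"
      using inj_on_subset[OF inj P] inj_on_subset[OF v(1) \<pi>P] by (rule comp_inj_on)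
    show "independent ((?v \<circ> \<pi>) ` P)"
      using \<pi>P by (intro independent_mono[OF v(2)]) auto
    show "(?v \<circ> \<pi>) k \<in> (case k of (i, j) \<Rightarrow> R_space A B C D i (lam i j))" if "k \<in> P" for k
    proof -
      obtain i j where ij: "\<pi> k = (i, j)" by fastforce
      have k: "k \<in> mode_indices \<nu>bar" using that P by blast
      then have mem: "(i, j) \<in> mode_indices \<nu>" using im ij by (metis image_eqI subsetD)
      \<comment> \<open>If \<open>\<pi> k\<close> is unobservable, the whole output vanishes;
        otherwise its output is that of \<open>k\<close>, and all the others vanish.\<close>
      have "v i j \<in> R_space A B C D (fst k) (lam (fst k) (snd k))"
      proof (rule closed_loop_eigenvector_in_R_space)
        show "(A + B ** F) *v v i j = lam (fst k) (snd k) *\<^sub>R v i j"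
          using basis mem \<pi>(1)[OF k] by (auto simp: decoupling_eigenbasis_def ij)
        fix q assume q: "fst k \<noteq> Some q"
        show "((C + D ** F) *v v i j) $ q = 0"
        proof (cases i)
          case None
          then show ?thesis using basis mem by (simp add: decoupling_eigenbasis_def mode_indices_def)
        next
          case (Some l)
          then have "l \<noteq> q" using q \<pi>(2)[OF k] by (auto simp: ij)
          moreover have "\<exists>c. (C + D ** F) *v v i j = c *\<^sub>R axis l 1"
            using observable[of l] mem Some unfolding mode_indices_def by blast
          ultimately show ?thesis by (auto simp: axis_def)
        qed
      qed
      then show ?thesis by (simp add: ij case_prod_beta)
    qed
  qed
qed

section \<open>Sufficiency: from a transversal to a decoupling feedback\<close>

text \<open>By independence the assignment of \<open>w k\<close> to \<open>u k\<close> extends to a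
  linear map, whose matrix is \<open>F\<close>. The equations defining \<open>R_space\<close> then
  become closed-loop equations.\<close>

lemma exists_feedback:
  fixes A :: "real^'n^'n" and B :: "real^'m^'n" and C :: "real^'n^'p" and D :: "real^'m^'p"
  assumes "\<And>k. k \<in> U \<Longrightarrow> u k \<in> R_space A B C D (i k) (l k)"
    and "inj_on u U" and "independent (u ` U)"
  shows "\<exists>F. \<forall>k\<in>U. (A + B ** F) *v u k = l k *\<^sub>R u k \<and>
    (\<forall>q. i k \<noteq> Some q \<longrightarrow> ((C + D ** F) *v u k) $ q = 0)"
proof -
  have "\<forall>k\<in>U. \<exists>w. (A - l k *\<^sub>R mat 1) *v u k + B *v w = 0 \<and>
      (\<forall>q. i k \<noteq> Some q \<longrightarrow> (C *v u k + D *v w) $ q = 0)"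
    using assms(1) unfolding R_space_def by blast
  then obtain w where w: "\<And>k. k \<in> U \<Longrightarrow> (A - l k *\<^sub>R mat 1) *v u k + B *v w k = 0"
      "\<And>k q. k \<in> U \<Longrightarrow> i k \<noteq> Some q \<Longrightarrow> (C *v u k + D *v w k) $ q = 0"
    by metis
  obtain f where f: "linear f" "\<And>x. x \<in> u ` U \<Longrightarrow> f x = w (inv_into U u x)"
    using linear_independent_extend[OF assms(3), of "\<lambda>x. w (inv_into U u x)"] by blast
  have F: "matrix f *v u k = w k" if "k \<in> U" for k
    using f that assms(2) by (simp add: matrix_works)
  show ?thesis
  proof (intro exI[of _ "matrix f"] ballI conjI allI impI)
    fix k assume k: "k \<in> U"
    have "(A + B ** matrix f) *v u k = A *v u k + B *v w k"
      by (simp add: matrix_vector_mult_add_rdistrib matrix_vector_mul_assoc[symmetric] F[OF k])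
    also have "\<dots> = l k *\<^sub>R u k"
      using w(1)[OF k] by (simp add: matrix_vector_mult_diff_rdistrib
          scaleR_matrix_vector_assoc[symmetric] algebra_simps)
    finally show "(A + B ** matrix f) *v u k = l k *\<^sub>R u k" .
    have "(C + D ** matrix f) *v u k = C *v u k + D *v w k"
      by (simp add: matrix_vector_mult_add_rdistrib matrix_vector_mul_assoc[symmetric] F[OF k])
    then show "((C + D ** matrix f) *v u k) $ q = 0" if "i k \<noteq> Some q" for q
      using w(2)[OF k that] by simp
  qed
qed

text \<open>The modes whose closed-loop eigenvector happens to be invisible at the output are moved to the
  unobservable family.\<close>

lemma exists_decoupling_eigenbasis:
  fixes A :: "real^'n^'n" and B :: "real^'m^'n" and C :: "real^'n^'p" and D :: "real^'m^'p"
    and \<nu>bar :: "'p option \<Rightarrow> nat"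
  assumes inj: "inj_on u (mode_indices \<nu>bar)" and indep: "independent (u ` mode_indices \<nu>bar)"
    and span: "span (u ` mode_indices \<nu>bar) = UNIV"
    and eig: "\<And>k. k \<in> mode_indices \<nu>bar \<Longrightarrow> (A + B ** F) *v u k = lam (fst k) (snd k) *\<^sub>R u k"
    and zero: "\<And>k q. k \<in> mode_indices \<nu>bar \<Longrightarrow> fst k \<noteq> Some q \<Longrightarrow> ((C + D ** F) *v u k) $ q = 0"
  shows "\<exists>\<nu> \<mu> v. decoupling_eigenbasis A B C D F \<nu> \<mu> v \<and>
    (\<forall>i. \<nu> (Some i) \<le> \<nu>bar (Some i)) \<and>
    (\<Sum>i\<in>UNIV. modes \<nu> \<mu> i) = (\<Sum>i\<in>UNIV. modes \<nu>bar lam i) \<and>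
    (\<forall>i. modes \<nu> \<mu> (Some i) \<subseteq># modes \<nu>bar lam (Some i)) \<and>
    modes \<nu>bar lam None \<subseteq># modes \<nu> \<mu> None"
proof -
  let ?U = "mode_indices \<nu>bar" and ?N = "C + D ** F" and ?lam = "\<lambda>(i, j). lam i j"
  \<comment> \<open>\<open>K None\<close> gathers every index whose eigenvector is invisible,
    whatever its first component; \<open>K (Some i)\<close> keeps the visible ones of output
    \<open>i\<close>.\<close>
  define K where "K i = {k \<in> ?U. if i = None then ?N *v u k = 0 else fst k = i \<and> ?N *v u k \<noteq> 0}" for i
  have finK: "finite (K i)" for i by (simp add: K_def finite_mode_indices)
  \<comment> \<open>For \<open>None\<close> no output row is dropped, so the whole output vanishes.
    Hence a visible index always belongs to an actual output.\<close>
  have vec0: "?N *v u k = 0" if "k \<in> ?U" "fst k = None" for k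
    using zero that by (simp add: vec_eq_iff)
  have K_Un: "(\<Union>i. K i) = ?U"
  proof (intro equalityI subsetI)
    fix k assume "k \<in> ?U"
    then have "k \<in> K (if ?N *v u k = 0 then None else fst k)"
      using vec0 by (auto simp: K_def)
    then show "k \<in> (\<Union>i. K i)" by blast
  qed (auto simp: K_def)
  have K_disj: "K i \<inter> K j = {}" if "i \<noteq> j" for i j
    using that by (auto simp: K_def split: if_splits)
  \<comment> \<open>Enumerating from one gives each \<open>K i\<close> the index range that
    \<open>mode_indices\<close> prescribes.\<close>
  have "\<exists>e. bij_betw e {1..card (K i)} (K i)" for i
    using ex_bij_betw_nat_finite_1[OF finK] .
  then obtain e where e: "\<And>i. bij_betw (e i) {1..card (K i)} (K i)" by metis
  define \<nu> where "\<nu> i = card (K i)" for i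
  define \<mu> where "\<mu> i j = ?lam (e i j)" for i j
  define v where "v i j = u (e i j)" for i j
  have e_in: "e i j \<in> K i" if "j \<in> {1..\<nu> i}" for i j
    using e that unfolding \<nu>_def by (blast dest: bij_betwE)
  have e_U: "e i j \<in> ?U" if "j \<in> {1..\<nu> i}" for i j
    using e_in[OF that] by (auto simp: K_def)
  have bij: "bij_betw (\<lambda>(i, j). e i j) (mode_indices \<nu>) ?U"
  proof (rule bij_betw_imageI)
    show "inj_on (\<lambda>(i, j). e i j) (mode_indices \<nu>)"
    proof (rule inj_onI)
      fix x y assume xy: "x \<in> mode_indices \<nu>" "y \<in> mode_indices \<nu>" "(case x of (i, j) \<Rightarrow> e i j) = (case y of (i, j) \<Rightarrow> e i j)"
      obtain i j where x: "x = (i, j)" by fastforce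
      obtain i' j' where y: "y = (i', j')" by fastforce
      have j: "j \<in> {1..\<nu> i}" "j' \<in> {1..\<nu> i'}" "e i j = e i' j'"
        using xy by (simp_all add: x y mode_indices_def)
      have "e i j \<in> K i \<inter> K i'" using e_in[OF j(1)] e_in[OF j(2)] j(3) by simp
      then have "i = i'" using K_disj[of i i'] by auto
      moreover have "inj_on (e i) {1..\<nu> i}" using e by (simp add: \<nu>_def bij_betw_def)
      ultimately show "x = y" using j by (simp add: x y inj_on_eq_iff)
    qed
    have "(\<lambda>(i, j). e i j) ` mode_indices \<nu> = (\<Union>i. e i ` {1..\<nu> i})"
      by (simp add: mode_indices_eq_Union image_UN image_image)
    also have "\<dots> = ?U" using e by (simp add: \<nu>_def bij_betw_def K_Un)
    finally show "(\<lambda>(i, j). e i j) ` mode_indices \<nu> = ?U" .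
  qed
  have v_eq: "(\<lambda>(i, j). v i j) = u \<circ> (\<lambda>(i, j). e i j)" by (auto simp: v_def)
  have v_im: "(\<lambda>(i, j). v i j) ` mode_indices \<nu> = u ` ?U"
    unfolding v_eq image_comp[symmetric] using bij by (simp add: bij_betw_def)
  have basis_v: "decoupling_eigenbasis A B C D F \<nu> \<mu> v"
    unfolding decoupling_eigenbasis_def v_im
  proof (intro conjI indep span)
    show "inj_on (\<lambda>(i, j). v i j) (mode_indices \<nu>)"
      unfolding v_eq using bij inj by (intro comp_inj_on) (auto simp: bij_betw_def)
    show "\<forall>(i, j)\<in>mode_indices \<nu>. (A + B ** F) *v v i j = \<mu> i j *\<^sub>R v i j"
      using eig e_U by (auto simp: v_def \<mu>_def case_prod_beta mode_indices_def)
    show "\<forall>j\<in>{1..\<nu> None}. ?N *v v None j = 0"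
      using e_in[of _ None] by (auto simp: v_def K_def)
    show "\<forall>i. \<forall>j\<in>{1..\<nu> (Some i)}. \<exists>c. c \<noteq> 0 \<and> ?N *v v (Some i) j = c *\<^sub>R axis i 1"
    proof (intro allI ballI)
      fix i j assume j: "j \<in> {1..\<nu> (Some i)}"
      let ?k = "e (Some i) j"
      have k: "?k \<in> ?U" "fst ?k = Some i" "?N *v u ?k \<noteq> 0" using e_in[OF j] by (auto simp: K_def)
      \<comment> \<open>All components but the \<open>i\<close>-th vanish, so that entry is the
        coefficient, and it is nonzero because the vector is.\<close>
      have "?N *v u ?k = (?N *v u ?k) $ i *\<^sub>R axis i 1"
        using zero[OF k(1)] k(2) by (auto simp: vec_eq_iff axis_def)
      moreover from this have "(?N *v u ?k) $ i \<noteq> 0" using k(3) by (metis scaleR_zero_left)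
      ultimately show "\<exists>c. c \<noteq> 0 \<and> ?N *v v (Some i) j = c *\<^sub>R axis i 1" unfolding v_def by blast
    qed
  qed
  have modes: "modes \<nu> \<mu> i = image_mset ?lam (mset_set (K i))" for i
  proof -
    have "mset_set (K i) = image_mset (e i) (mset_set {1..\<nu> i})"
      using e[of i] by (simp add: \<nu>_def bij_betw_def image_mset_mset_set)
    moreover have "\<mu> i = ?lam \<circ> e i" by (auto simp: \<mu>_def)
    ultimately show ?thesis by (simp only: modes_def multiset.map_comp)
  qed
  \<comment> \<open>Indices only ever move from an output to \<open>None\<close>, so the required
    multiset inclusions come from inclusions of index sets.\<close>
  have K_Some: "K (Some i) \<subseteq> Pair (Some i) ` {1..\<nu>bar (Some i)}" for i
    by (auto simp: K_def mode_indices_def)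
  have \<nu>_le: "\<nu> (Some i) \<le> \<nu>bar (Some i)" for i
    using card_mono[OF _ K_Some[of i]] by (simp add: \<nu>_def card_image inj_on_def)
  have K_None: "Pair None ` {1..\<nu>bar None} \<subseteq> K None"
    using vec0 by (auto simp: K_def mode_indices_def)
  have total: "(\<Sum>i\<in>UNIV. modes \<nu> \<mu> i) = (\<Sum>i\<in>UNIV. modes \<nu>bar lam i)"
    unfolding modes sum_modes using K_disj finK
    by (subst sum_image_mset_mset_set) (simp_all add: K_Un)
  have "modes \<nu> \<mu> (Some i) \<subseteq># modes \<nu>bar lam (Some i)" for i
    unfolding modes modes_eq_image_mset[of \<nu>bar]
    by (intro image_mset_subseteq_mono subset_imp_msubset_mset_set K_Some) simp
  moreover have "modes \<nu>bar lam None \<subseteq># modes \<nu> \<mu> None"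
    unfolding modes modes_eq_image_mset[of \<nu>bar]
    by (intro image_mset_subseteq_mono subset_imp_msubset_mset_set K_None finK)
  ultimately show ?thesis
    using basis_v \<nu>_le total by blast
qed

lemma card_mode_indices:
  fixes \<nu> :: "'p::finite option \<Rightarrow> nat"
  shows "card (mode_indices \<nu>) = \<nu> None + (\<Sum>i\<in>UNIV. \<nu> (Some i))"
  by (simp add: mode_indices_def UNIV_option_conv sum.reindex)

theorem theorem17:
  fixes td :: time_domain
    and A :: "real^'n^'n" and B :: "real^'m^'n" and C :: "real^'n^'p" and D :: "real^'m^'p"
    and \<nu>bar :: "'p option \<Rightarrow> nat" and lam :: "'p option \<Rightarrow> nat \<Rightarrow> real"
  assumes "right_invertible A B C D"
    and "stabilizable td A B"
    and "\<not> invariant_zero A B C D (complex_of_real (dc_point td))"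
    and "\<And>z. minimum_phase_zero td A B C D z \<Longrightarrow>
           algebraic_mult (pencil A B C D) z = geometric_mult (pencil A B C D) z"
    and "\<And>z. minimum_phase_zero td A B C D z \<Longrightarrow> z \<in> \<real>"
    and "\<nu>bar None + (\<Sum>i\<in>UNIV. \<nu>bar (Some i)) = CARD('n)"
    and "\<And>i j. j \<in> {1..\<nu>bar i} \<Longrightarrow> complex_of_real (lam i j) \<in> stable_region td"
  shows "solvable_3A td A B C D \<nu>bar lam \<longleftrightarrow>
    (\<forall>P \<in> Pow (mode_indices \<nu>bar).
       dim (subspace_sum (\<lambda>(i, j). R_space A B C D i (lam i j)) P) \<ge> card P)"
    (is "_ \<longleftrightarrow> ?dims")
proof
  assume "solvable_3A td A B C D \<nu>bar lam"
  then obtain F \<nu> \<mu> v where "decoupling_eigenbasis A B C D F \<nu> \<mu> v"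
    "(\<Sum>i\<in>UNIV. modes \<nu> \<mu> i) = (\<Sum>i\<in>UNIV. modes \<nu>bar lam i)"
    "\<And>i. modes \<nu> \<mu> (Some i) \<subseteq># modes \<nu>bar lam (Some i)"
    unfolding solvable_3A_def solves_problem_3A_def state_output_decoupled_def by blast
  then show ?dims using dim_condition_of_eigenbasis[of A B C D F \<nu> \<mu> v \<nu>bar lam] by blast
next
  assume ?dims
  let ?U = "mode_indices \<nu>bar"
  have "\<exists>u. (\<forall>k\<in>?U. u k \<in> (case k of (i, j) \<Rightarrow> R_space A B C D i (lam i j))) \<and> inj_on u ?U \<and>
      independent (u ` ?U)"
  proof (rule rado_subspaces[OF finite_mode_indices])
    show "subspace (case k of (i, j) \<Rightarrow> R_space A B C D i (lam i j))" for k
      by (simp add: case_prod_beta subspace_R_space)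
  qed (use \<open>?dims\<close> in auto)
  then obtain u where u: "\<And>k. k \<in> ?U \<Longrightarrow> u k \<in> R_space A B C D (fst k) (lam (fst k) (snd k))"
      and inj: "inj_on u ?U" and indep: "independent (u ` ?U)"
    by (auto simp: case_prod_beta)
  \<comment> \<open>There are \<open>CARD('n)\<close> indices in all, so the independent transversal
    is a basis of the state space.\<close>
  have "card (u ` ?U) = DIM(real^'n)"
    using assms(6) by (simp add: card_image[OF inj] card_mode_indices)
  then have span: "span (u ` ?U) = UNIV"
    using indep card_ge_dim_independent[of "u ` ?U" UNIV] by auto
  obtain F where eig: "\<And>k. k \<in> ?U \<Longrightarrow> (A + B ** F) *v u k = lam (fst k) (snd k) *\<^sub>R u k"
    and zero: "\<And>k q. k \<in> ?U \<Longrightarrow> fst k \<noteq> Some q \<Longrightarrow> ((C + D ** F) *v u k) $ q = 0"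
    using exists_feedback[of ?U u A B C D fst "\<lambda>k. lam (fst k) (snd k)", OF u inj indep] by blast
  \<comment> \<open>Stability and tracking are read off the assigned indexing; the regrouping into
    observable and unobservable modes follows for the same \<open>F\<close>.\<close>
  have "real_eigenbasis (A + B ** F) ?U u (\<lambda>k. lam (fst k) (snd k))"
    using inj indep span eig by unfold_locales (auto simp: finite_mode_indices)
  moreover have "complex_of_real (lam (fst k) (snd k)) \<in> stable_region td" if "k \<in> ?U" for k
    using assms(7) that by (auto simp: mode_indices_def)
  ultimately have "spectrum (A + B ** F) \<subseteq> stable_region td \<and>
      (\<exists>G. static_gain td A B C D F ** G = mat 1 \<and> tracks_constant_references td A B C D F G)"
    by (rule exists_tracking_feedforward[OF assms(1,3)])
  then obtain G where G: "spectrum (A + B ** F) \<subseteq> stable_region td"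
    "static_gain td A B C D F ** G = mat 1" "tracks_constant_references td A B C D F G"
    by blast
  obtain \<nu> \<mu> v where v: "decoupling_eigenbasis A B C D F \<nu> \<mu> v"
    and modes: "\<forall>i. \<nu> (Some i) \<le> \<nu>bar (Some i)"
    "(\<Sum>i\<in>UNIV. modes \<nu> \<mu> i) = (\<Sum>i\<in>UNIV. modes \<nu>bar lam i)"
    "\<forall>i. modes \<nu> \<mu> (Some i) \<subseteq># modes \<nu>bar lam (Some i)"
    "modes \<nu>bar lam None \<subseteq># modes \<nu> \<mu> None"
    using exists_decoupling_eigenbasis[where lam = lam, OF inj indep span eig zero] by blast
  have "state_output_decoupled td A B C D F \<nu> \<mu>"
    unfolding state_output_decoupled_def using decoupled_responses_of_eigenbasis[OF v] v by (intro conjI exI)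
  then have "solves_problem_3A td A B C D \<nu>bar lam F G"
    unfolding solves_problem_3A_def using G modes by (intro conjI exI)
  then show "solvable_3A td A B C D \<nu>bar lam"
    unfolding solvable_3A_def by (intro exI)
qed

end
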